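(* Let $n\ge 1$, let $A_n(a)$ be the $A_n$-type quiver with an arbitrary orientation $a$, and let $\Sigma$ be a section of the Auslander–Reiten quiver of $A_n$ with $\Sigma^{\mathrm{op}}\cong A_n(a)$. Let $X,Y$ be zigzag persistence modules in $\operatorname{rep}_{\Bbbk}A_n(a)$. Then, for the distances induced by the derived equivalence $\operatorname{RHom}(T(\Sigma),-)$, $$d_B^{T,a}(\mathcal B(X),\mathcal B(Y))\le d_I^{T,a}(X,Y).$$
   Context: $\Bbbk$ is an algebraically closed field; representations are finite-dimensional. $A_n(a)$ is a quiver with underlying graph $1-2-\cdots-n$ and arrows oriented according to $a$; $A_n$ is the equioriented one $1\to2\to\cdots\to n$. For $1\le b\le d\le n$, $\mathbb I[b,d]$ is the interval representation ($\Bbbk$ on $[b,d]$, identities inside, zero elsewhere); every representation $M$ of $A_n(a)$ decomposes uniquely as $\bigoplus\mathbb I[b,d]^{m(b,d)}$, and $\mathcal B(M)$ is the multiset of intervals $\langle b,d\rangle$ with multiplicities $m(b,d)$. Distances on $\mathsf{D}^{\mathrm b}(\operatorname{rep}_{\Bbbk}A_n)$. For an integer $\delta\ge0$, $M(\delta)_x=M_{x+\delta}$ if $x+\delta\le n$, $0$ otherwise (an exact functor on $\operatorname{rep}_{\Bbbk}A_n$, extended termwise to complexes); $\phi_M^{\delta}\colon M\to M(\delta)$ is given by the structure maps $M_x\to M_{x+\delta}$ (zero if $x+\delta>n$). A $\delta$-interleaving pair between $M,N$ is $f\colon M\to N(\delta)$, $g\colon N\to M(\delta)$ with $g(\delta)f=\phi_M^{2\delta}$,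 $f(\delta)g=\phi_N^{2\delta}$. Complexes $X^\bullet,Y^\bullet$ are derived $\delta$-interleaved if there are morphisms $f^\bullet\colon X^\bullet\to Y^\bullet(\delta)$, $g^\bullet\colon Y^\bullet\to X^\bullet(\delta)$ in $\mathsf{D}^{\mathrm b}(\operatorname{rep}_{\Bbbk}A_n)$ such that $(H^i(f^\bullet),H^i(g^\bullet))$ is a $\delta$-interleaving pair for all $i$; $d_I^D$ is the infimum of such integers $\delta\ge 0$. A $\delta$-matching of barcodes $\mathcal B,\mathcal B'$ is a bijection $\sigma$ between sub-multisets such that all intervals of $\mathcal B$ and $\mathcal B'$ with $d-b\ge2\delta$ are matched and $\sigma\langle b,d\rangle=\langle b',d'\rangle$ implies $b'-\delta\le b\le d\le d'+\delta$ and $b-\delta\le b'\le d'\le d+\delta$. $\mathcal B^D(X^\bullet)=\bigsqcup_i\mathcal B(H^i(X^\bullet))$; $d_B^D(\mathcal B^D(X^\bullet),\mathcal B^D(Y^\bullet))$ is the infimum of integers $\delta\ge0$ such that $\mathcal B(H^i(X^\bullet))$ and $\mathcal B(H^i(Y^\bullet))$ admit a $\delta$-matching for every $i$. Derived equivalence. Let $\tau$ be the Auslander–Reiten translation of $\operatorname{rep}_{\Bbbk}A_n$ and $O(P_i)$ the $\tau$-orbit of the indecomposable projective $P_i=\mathbb I[i,n]$. A section $\Sigma$ of the AR quiver of $A_n$ is a connected full subquiver formed by one representative $X_i\in O(P_i)$ of each $\tau$-orbit, $i=1,\dots,n$; $T(\Sigma)=\bigoplus_{i=1}^nX_i$. It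 is a classical tilting module and $\operatorname{End}(T(\Sigma))^{\mathrm{op}}$ is the path algebra of $\Sigma^{\mathrm{op}}\cong A_n(a)$, so that $\operatorname{RHom}(T(\Sigma),-)\colon\mathsf{D}^{\mathrm b}(\operatorname{rep}_{\Bbbk}A_n)\to\mathsf{D}^{\mathrm b}(\operatorname{rep}_{\Bbbk}A_n(a))$ is a derived equivalence. Let $E$ be a quasi-inverse. Regarding representations as stalk complexes in degree $0$, put $d_I^{T,a}(X,Y):=d_I^D(E(X),E(Y))$ and $d_B^{T,a}(\mathcal B(X),\mathcal B(Y)):=d_B^D(\mathcal B^D(E(X)),\mathcal B^D(E(Y)))$. *)

theory Defs
  imports
    "HOL-Library.Multiset"
    "HOL-Library.Extended_Nat"
    "HOL-Computational_Algebra.Polynomial"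
    "Jordan_Normal_Form.Matrix_Kernel"
begin

section \<open>Representations of quivers of type A\<close>

text \<open>
  An orientation \<open>a\<close> of the graph \<open>1 - 2 - \<dots> - n\<close> is a predicate on its edges: the edge
  between \<open>i\<close> and \<open>i + 1\<close>, which is called edge \<open>i\<close>, is the arrow \<open>i \<rightarrow> i + 1\<close> if \<open>a i\<close> holds
  and \<open>i + 1 \<rightarrow> i\<close> otherwise.
\<close>

definition asrc :: "(nat \<Rightarrow> bool) \<Rightarrow> nat \<Rightarrow> nat" where
  "asrc a i = (if a i then i else i + 1)"

definition atgt :: "(nat \<Rightarrow> bool) \<Rightarrow> nat \<Rightarrow> nat" where
  "atgt a i = (if a i then i + 1 else i)"

definition equi :: "nat \<Rightarrow> bool" where
  "equi = (\<lambda>_. True)"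

text \<open>
  Finite-dimensional representations are taken in matrix form: the space at vertex \<open>x\<close> is
  \<open>k ^ vdim M x\<close>, and \<open>arr M i\<close> is the matrix of the arrow on edge \<open>i\<close>. Choosing bases at the
  vertices makes this category equivalent to that of vector space valued representations.
  Outside \<open>{1..n}\<close> all spaces vanish, so that the matrices there are empty and carry no data;
  equality of representations and of morphisms is therefore plain equality.
\<close>

record 'k rep =
  vdim :: "nat \<Rightarrow> nat"
  arr :: "nat \<Rightarrow> 'k mat"

type_synonym 'k rmap = "nat \<Rightarrow> 'k mat"

definition is_rep :: "nat \<Rightarrow> (nat \<Rightarrow> bool) \<Rightarrow> 'k rep \<Rightarrow> bool" where
  "is_rep n a M \<longleftrightarrow>
     (\<forall>x. x \<notin> {1..n} \<longrightarrow> vdim M x = 0) \<and>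
     (\<forall>i. arr M i \<in> carrier_mat (vdim M (atgt a i)) (vdim M (asrc a i)))"

definition rep_hom :: "(nat \<Rightarrow> bool) \<Rightarrow> 'k::field rep \<Rightarrow> 'k rep \<Rightarrow> 'k rmap set" where
  "rep_hom a M N =
     {f. (\<forall>x. f x \<in> carrier_mat (vdim N x) (vdim M x)) \<and>
         (\<forall>i. f (atgt a i) * arr M i = arr N i * f (asrc a i))}"

definition rep_id :: "'k::field rep \<Rightarrow> 'k rmap" where
  "rep_id M = (\<lambda>x. 1\<^sub>m (vdim M x))"

definition rep_comp :: "'k::field rmap \<Rightarrow> 'k rmap \<Rightarrow> 'k rmap" where
  "rep_comp g f = (\<lambda>x. g x * f x)"

definition rep_iso :: "(nat \<Rightarrow> bool) \<Rightarrow> 'k::field rep \<Rightarrow> 'k rep \<Rightarrow> 'k rmap \<Rightarrow> bool" where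
  "rep_iso a M N f \<longleftrightarrow> f \<in> rep_hom a M N \<and>
     (\<exists>g\<in>rep_hom a N M. rep_comp g f = rep_id M \<and> rep_comp f g = rep_id N)"

definition rep_isomorphic :: "(nat \<Rightarrow> bool) \<Rightarrow> 'k::field rep \<Rightarrow> 'k rep \<Rightarrow> bool" where
  "rep_isomorphic a M N \<longleftrightarrow> (\<exists>f. rep_iso a M N f)"

definition rep_zero :: "'k::field rep" where
  "rep_zero = \<lparr>vdim = (\<lambda>_. 0), arr = (\<lambda>_. 0\<^sub>m 0 0)\<rparr>"

definition rep_dsum :: "'k::field rep list \<Rightarrow> 'k rep" where
  "rep_dsum Ms = \<lparr>vdim = (\<lambda>x. \<Sum>M\<leftarrow>Ms. vdim M x),
                  arr = (\<lambda>i. diag_block_mat (map (\<lambda>M. arr M i) Ms))\<rparr>"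

definition interval_rep :: "(nat \<Rightarrow> bool) \<Rightarrow> nat \<times> nat \<Rightarrow> 'k::field rep" where
  "interval_rep a = (\<lambda>(b, d).
     (let dm = (\<lambda>x. if b \<le> x \<and> x \<le> d then 1 else 0)
      in \<lparr>vdim = dm,
          arr = (\<lambda>i. if b \<le> i \<and> i + 1 \<le> d then 1\<^sub>m 1
                     else 0\<^sub>m (dm (atgt a i)) (dm (asrc a i)))\<rparr>))"

text \<open>The barcode is the multiset of intervals in the (unique) interval decomposition.\<close>

definition is_barcode :: "nat \<Rightarrow> (nat \<Rightarrow> bool) \<Rightarrow> 'k::field rep \<Rightarrow> (nat \<times> nat) multiset \<Rightarrow> bool" where
  "is_barcode n a M B \<longleftrightarrow>
     (\<forall>(b, d)\<in>#B. 1 \<le> b \<and> b \<le> d \<and> d \<le> n) \<and>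
     (\<exists>xs. mset xs = B \<and> rep_isomorphic a M (rep_dsum (map (interval_rep a) xs)))"

definition barcode :: "nat \<Rightarrow> (nat \<Rightarrow> bool) \<Rightarrow> 'k::field rep \<Rightarrow> (nat \<times> nat) multiset" where
  "barcode n a M = (THE B. is_barcode n a M B)"


section \<open>Shifts, interleavings and matchings\<close>

definition rep_shift :: "nat \<Rightarrow> nat \<Rightarrow> 'k::field rep \<Rightarrow> 'k rep" where
  "rep_shift n \<delta> M =
     (let dm = (\<lambda>x. if 1 \<le> x \<and> x + \<delta> \<le> n then vdim M (x + \<delta>) else 0)
      in \<lparr>vdim = dm,
          arr = (\<lambda>i. if 1 \<le> i \<and> i + 1 + \<delta> \<le> n then arr M (i + \<delta>)
                     else 0\<^sub>m (dm (i + 1)) (dm i))\<rparr>)"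

definition rmap_shift :: "nat \<Rightarrow> nat \<Rightarrow> 'k::field rmap \<Rightarrow> 'k rmap" where
  "rmap_shift n \<delta> f = (\<lambda>x. if 1 \<le> x \<and> x + \<delta> \<le> n then f (x + \<delta>) else 0\<^sub>m 0 0)"

text \<open>\<open>structure_map M x k\<close> is the structure map \<open>M\<^sub>x \<rightarrow> M\<^sub>y\<close>, where \<open>y = x + k\<close>.\<close>

fun structure_map :: "'k::field rep \<Rightarrow> nat \<Rightarrow> nat \<Rightarrow> 'k mat" where
  "structure_map M x 0 = 1\<^sub>m (vdim M x)"
| "structure_map M x (Suc k) = arr M (x + k) * structure_map M x k"

definition shift_unit :: "nat \<Rightarrow> nat \<Rightarrow> 'k::field rep \<Rightarrow> 'k rmap" where
  "shift_unit n \<delta> M =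
     (\<lambda>x. if 1 \<le> x \<and> x + \<delta> \<le> n then structure_map M x \<delta> else 0\<^sub>m 0 (vdim M x))"

definition interleaving_pair ::
  "nat \<Rightarrow> nat \<Rightarrow> 'k::field rep \<Rightarrow> 'k rep \<Rightarrow> 'k rmap \<Rightarrow> 'k rmap \<Rightarrow> bool" where
  "interleaving_pair n \<delta> M N f g \<longleftrightarrow>
     f \<in> rep_hom equi M (rep_shift n \<delta> N) \<and>
     g \<in> rep_hom equi N (rep_shift n \<delta> M) \<and>
     rep_comp (rmap_shift n \<delta> g) f = shift_unit n (2 * \<delta>) M \<and>
     rep_comp (rmap_shift n \<delta> f) g = shift_unit n (2 * \<delta>) N"

text \<open>
  A bijection between sub-multisets is given by the multiset of the pairs of matched elements.
\<close>

definition is_matching ::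
  "nat \<Rightarrow> (nat \<times> nat) multiset \<Rightarrow> (nat \<times> nat) multiset \<Rightarrow>
   ((nat \<times> nat) \<times> (nat \<times> nat)) multiset \<Rightarrow> bool" where
  "is_matching \<delta> B B' \<sigma> \<longleftrightarrow>
     image_mset fst \<sigma> \<subseteq># B \<and> image_mset snd \<sigma> \<subseteq># B' \<and>
     (\<forall>(b, d)\<in>#B - image_mset fst \<sigma>. \<not> int d - int b \<ge> 2 * int \<delta>) \<and>
     (\<forall>(b, d)\<in>#B' - image_mset snd \<sigma>. \<not> int d - int b \<ge> 2 * int \<delta>) \<and>
     (\<forall>((b, d), (b', d'))\<in>#\<sigma>.
        int b' - int \<delta> \<le> int b \<and> b \<le> d \<and> d \<le> d' + \<delta> \<and>
        int b - int \<delta> \<le> int b' \<and> b' \<le> d' \<and> d' \<le> d + \<delta>)"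


section \<open>Complexes and cohomology\<close>

text \<open>Cochain complexes; \<open>diff C i\<close> is the differential from degree \<open>i\<close> to degree \<open>i + 1\<close>.\<close>

record 'k cx =
  deg :: "int \<Rightarrow> 'k rep"
  diff :: "int \<Rightarrow> 'k rmap"

type_synonym 'k cmap = "int \<Rightarrow> 'k rmap"

definition is_bounded_cx :: "nat \<Rightarrow> (nat \<Rightarrow> bool) \<Rightarrow> 'k::field cx \<Rightarrow> bool" where
  "is_bounded_cx n a C \<longleftrightarrow>
     (\<forall>i. is_rep n a (deg C i)) \<and>
     (\<forall>i. diff C i \<in> rep_hom a (deg C i) (deg C (i + 1))) \<and>
     (\<forall>i x. diff C (i + 1) x * diff C i x = 0\<^sub>m (vdim (deg C (i + 2)) x) (vdim (deg C i) x)) \<and>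
     (\<exists>N. \<forall>i. N < \<bar>i\<bar> \<longrightarrow> (\<forall>x. vdim (deg C i) x = 0))"

definition cx_hom :: "(nat \<Rightarrow> bool) \<Rightarrow> 'k::field cx \<Rightarrow> 'k cx \<Rightarrow> 'k cmap set" where
  "cx_hom a C D =
     {f. (\<forall>i. f i \<in> rep_hom a (deg C i) (deg D i)) \<and>
         (\<forall>i. rep_comp (f (i + 1)) (diff C i) = rep_comp (diff D i) (f i))}"

definition cx_id :: "'k::field cx \<Rightarrow> 'k cmap" where
  "cx_id C = (\<lambda>i. rep_id (deg C i))"

definition cx_comp :: "'k::field cmap \<Rightarrow> 'k cmap \<Rightarrow> 'k cmap" where
  "cx_comp g f = (\<lambda>i. rep_comp (g i) (f i))"

definition homotopic ::
  "(nat \<Rightarrow> bool) \<Rightarrow> 'k::field cx \<Rightarrow> 'k cx \<Rightarrow> 'k cmap \<Rightarrow> 'k cmap \<Rightarrow> bool" where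
  "homotopic a C D f g \<longleftrightarrow>
     (\<exists>h. (\<forall>i. h i \<in> rep_hom a (deg C i) (deg D (i - 1))) \<and>
          (\<forall>i x. f i x - g i x = diff D (i - 1) x * h i x + h (i + 1) x * diff C i x))"

definition stalk :: "'k::field rep \<Rightarrow> 'k cx" where
  "stalk M =
     (let X = (\<lambda>i. if i = 0 then M else rep_zero)
      in \<lparr>deg = X, diff = (\<lambda>i x. 0\<^sub>m (vdim (X (i + 1)) x) (vdim (X i) x))\<rparr>)"

definition cx_shift :: "nat \<Rightarrow> nat \<Rightarrow> 'k::field cx \<Rightarrow> 'k cx" where
  "cx_shift n \<delta> C = \<lparr>deg = (\<lambda>i. rep_shift n \<delta> (deg C i)), diff = (\<lambda>i. rmap_shift n \<delta> (diff C i))\<rparr>"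

text \<open>
  Cohomology is formed vertexwise. For composable matrices \<open>B\<close>, \<open>A\<close> with \<open>A B = 0\<close>, the
  quotient \<open>ker A / im B\<close> is realized as \<open>k ^ h\<close> through a matrix \<open>P\<close> with \<open>h\<close> rows that maps
  \<open>ker A\<close> onto \<open>k ^ h\<close> with kernel \<open>im B\<close>. The chosen \<open>P\<close> depends on \<open>B\<close> and \<open>A\<close> only, hence
  the exact functor \<open>rep_shift\<close> commutes with cohomology on the nose.
\<close>

definition mat_image :: "'k::field mat \<Rightarrow> 'k vec set" where
  "mat_image A = (\<lambda>v. A *\<^sub>v v) ` carrier_vec (dim_col A)"

definition is_coh_proj :: "'k::field mat \<Rightarrow> 'k mat \<Rightarrow> 'k mat \<Rightarrow> bool" where
  "is_coh_proj B A P \<longleftrightarrow> dim_col P = dim_col A \<and>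
     (\<lambda>v. P *\<^sub>v v) ` mat_kernel A = carrier_vec (dim_row P) \<and>
     (\<forall>v\<in>mat_kernel A. P *\<^sub>v v = 0\<^sub>v (dim_row P) \<longleftrightarrow> v \<in> mat_image B)"

definition coh_proj :: "'k::field mat \<Rightarrow> 'k mat \<Rightarrow> 'k mat" where
  "coh_proj B A = (SOME P. is_coh_proj B A P)"

definition cx_proj :: "'k::field cx \<Rightarrow> int \<Rightarrow> nat \<Rightarrow> 'k mat" where
  "cx_proj C i x = coh_proj (diff C (i - 1) x) (diff C i x)"

text \<open>The matrix induced on the quotients \<open>P\<close>, \<open>P'\<close> by a matrix \<open>F\<close>.\<close>

definition induced :: "'k::field mat \<Rightarrow> 'k mat \<Rightarrow> 'k mat \<Rightarrow> 'k mat \<Rightarrow> 'k mat" where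
  "induced A P P' F =
     (THE m. m \<in> carrier_mat (dim_row P') (dim_row P) \<and>
             (\<forall>v\<in>mat_kernel A. m *\<^sub>v (P *\<^sub>v v) = P' *\<^sub>v (F *\<^sub>v v)))"

definition cohom :: "(nat \<Rightarrow> bool) \<Rightarrow> int \<Rightarrow> 'k::field cx \<Rightarrow> 'k rep" where
  "cohom a i C =
     \<lparr>vdim = (\<lambda>x. dim_row (cx_proj C i x)),
      arr = (\<lambda>j. induced (diff C i (asrc a j)) (cx_proj C i (asrc a j))
                         (cx_proj C i (atgt a j)) (arr (deg C i) j))\<rparr>"

definition cohom_map :: "int \<Rightarrow> 'k::field cx \<Rightarrow> 'k cx \<Rightarrow> 'k cmap \<Rightarrow> 'k rmap" where
  "cohom_map i C D f = (\<lambda>x. induced (diff C i x) (cx_proj C i x) (cx_proj D i x) (f i x))"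

definition quasi_iso :: "(nat \<Rightarrow> bool) \<Rightarrow> 'k::field cx \<Rightarrow> 'k cx \<Rightarrow> 'k cmap \<Rightarrow> bool" where
  "quasi_iso a C D f \<longleftrightarrow> f \<in> cx_hom a C D \<and>
     (\<forall>i. rep_iso a (cohom a i C) (cohom a i D) (cohom_map i C D f))"


section \<open>Categories, functors and quasi-inverses\<close>

record ('o, 'm) category =
  Ob :: "'o set"
  Mor :: "'o \<Rightarrow> 'o \<Rightarrow> 'm set"
  Idm :: "'o \<Rightarrow> 'm"
  Cmp :: "'m \<Rightarrow> 'm \<Rightarrow> 'm"

record ('o, 'm, 'p, 'q) func =
  fob :: "'o \<Rightarrow> 'p"
  fmor :: "'m \<Rightarrow> 'q"

definition is_functor ::
  "('o, 'm) category \<Rightarrow> ('p, 'q) category \<Rightarrow> ('o, 'm, 'p, 'q) func \<Rightarrow> bool" where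
  "is_functor C D F \<longleftrightarrow>
     (\<forall>A\<in>Ob C. fob F A \<in> Ob D) \<and>
     (\<forall>A\<in>Ob C. \<forall>B\<in>Ob C. \<forall>f\<in>Mor C A B. fmor F f \<in> Mor D (fob F A) (fob F B)) \<and>
     (\<forall>A\<in>Ob C. fmor F (Idm C A) = Idm D (fob F A)) \<and>
     (\<forall>A\<in>Ob C. \<forall>B\<in>Ob C. \<forall>E\<in>Ob C. \<forall>f\<in>Mor C A B. \<forall>g\<in>Mor C B E.
        fmor F (Cmp C g f) = Cmp D (fmor F g) (fmor F f))"

definition func_id :: "('o, 'm, 'o, 'm) func" where
  "func_id = \<lparr>fob = (\<lambda>A. A), fmor = (\<lambda>f. f)\<rparr>"

definition func_comp ::
  "('p, 'q, 'r, 's) func \<Rightarrow> ('o, 'm, 'p, 'q) func \<Rightarrow> ('o, 'm, 'r, 's) func" where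
  "func_comp G F = \<lparr>fob = fob G \<circ> fob F, fmor = fmor G \<circ> fmor F\<rparr>"

definition is_isomorphism :: "('o, 'm) category \<Rightarrow> 'o \<Rightarrow> 'o \<Rightarrow> 'm \<Rightarrow> bool" where
  "is_isomorphism C A B f \<longleftrightarrow> f \<in> Mor C A B \<and>
     (\<exists>g\<in>Mor C B A. Cmp C g f = Idm C A \<and> Cmp C f g = Idm C B)"

definition naturally_isomorphic ::
  "('o, 'm) category \<Rightarrow> ('p, 'q) category \<Rightarrow> ('o, 'm, 'p, 'q) func \<Rightarrow> ('o, 'm, 'p, 'q) func \<Rightarrow> bool"
  where
  "naturally_isomorphic C D F G \<longleftrightarrow>
     (\<exists>\<eta>. (\<forall>A\<in>Ob C. is_isomorphism D (fob F A) (fob G A) (\<eta> A)) \<and>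
          (\<forall>A\<in>Ob C. \<forall>B\<in>Ob C. \<forall>f\<in>Mor C A B.
             Cmp D (\<eta> B) (fmor F f) = Cmp D (fmor G f) (\<eta> A)))"

definition quasi_inverse ::
  "('o, 'm) category \<Rightarrow> ('p, 'q) category \<Rightarrow>
   ('o, 'm, 'p, 'q) func \<Rightarrow> ('p, 'q, 'o, 'm) func \<Rightarrow> bool" where
  "quasi_inverse C D F E \<longleftrightarrow>
     is_functor C D F \<and> is_functor D C E \<and>
     naturally_isomorphic C C (func_comp E F) func_id \<and>
     naturally_isomorphic D D (func_comp F E) func_id"


section \<open>The bounded derived category\<close>

text \<open>
  A roof \<open>C \<leftarrow> Z \<rightarrow> D\<close> has a quasi-isomorphism as its left leg. Morphisms of the bounded derived
  category are equivalence classes of roofs in the bounded homotopy category. A roof records its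
  end points, so that a class determines its domain and codomain.
\<close>

record 'k roof =
  rsrc :: "'k cx"
  apex :: "'k cx"
  rtgt :: "'k cx"
  lleg :: "'k cmap"
  rleg :: "'k cmap"

definition is_roof ::
  "nat \<Rightarrow> (nat \<Rightarrow> bool) \<Rightarrow> 'k::field cx \<Rightarrow> 'k cx \<Rightarrow> 'k roof \<Rightarrow> bool" where
  "is_roof n a C D r \<longleftrightarrow> rsrc r = C \<and> rtgt r = D \<and>
     is_bounded_cx n a C \<and> is_bounded_cx n a D \<and> is_bounded_cx n a (apex r) \<and>
     quasi_iso a (apex r) C (lleg r) \<and> rleg r \<in> cx_hom a (apex r) D"

definition roof_equiv :: "nat \<Rightarrow> (nat \<Rightarrow> bool) \<Rightarrow> 'k::field roof \<Rightarrow> 'k roof \<Rightarrow> bool" where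
  "roof_equiv n a r r' \<longleftrightarrow>
     is_roof n a (rsrc r) (rtgt r) r \<and> is_roof n a (rsrc r) (rtgt r) r' \<and>
     (\<exists>W u v. is_bounded_cx n a W \<and> u \<in> cx_hom a W (apex r) \<and> v \<in> cx_hom a W (apex r') \<and>
        quasi_iso a W (rsrc r) (cx_comp (lleg r) u) \<and>
        homotopic a W (rsrc r) (cx_comp (lleg r) u) (cx_comp (lleg r') v) \<and>
        homotopic a W (rtgt r) (cx_comp (rleg r) u) (cx_comp (rleg r') v))"

definition roof_class :: "nat \<Rightarrow> (nat \<Rightarrow> bool) \<Rightarrow> 'k::field roof \<Rightarrow> 'k roof set" where
  "roof_class n a r = {r'. roof_equiv n a r r'}"

definition map_roof :: "'k::field cx \<Rightarrow> 'k cx \<Rightarrow> 'k cmap \<Rightarrow> 'k roof" where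
  "map_roof C D f = \<lparr>rsrc = C, apex = C, rtgt = D, lleg = cx_id C, rleg = f\<rparr>"

text \<open>
  The composite of two classes of roofs: complete a roof \<open>(C \<leftarrow> Z \<rightarrow> D)\<close> in the first class and a
  roof \<open>(D \<leftarrow> Z' \<rightarrow> E)\<close> in the second one by an Ore square on top.
\<close>

definition roof_comp ::
  "nat \<Rightarrow> (nat \<Rightarrow> bool) \<Rightarrow> 'k::field roof set \<Rightarrow> 'k roof set \<Rightarrow> 'k roof set" where
  "roof_comp n a \<gamma> \<phi> =
     {t. \<exists>r\<in>\<phi>. \<exists>s\<in>\<gamma>. rtgt r = rsrc s \<and>
         (\<exists>W u v. is_bounded_cx n a W \<and> quasi_iso a W (apex r) u \<and> v \<in> cx_hom a W (apex s) \<and>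
            homotopic a W (rtgt r) (cx_comp (rleg r) u) (cx_comp (lleg s) v) \<and>
            t \<in> roof_class n a
                  \<lparr>rsrc = rsrc r, apex = W, rtgt = rtgt s,
                   lleg = cx_comp (lleg r) u, rleg = cx_comp (rleg s) v\<rparr>)}"

definition Db :: "nat \<Rightarrow> (nat \<Rightarrow> bool) \<Rightarrow> ('k::field cx, 'k roof set) category" where
  "Db n a =
     \<lparr>Ob = {C. is_bounded_cx n a C},
      Mor = (\<lambda>C D. {roof_class n a r | r. is_roof n a C D r}),
      Idm = (\<lambda>C. roof_class n a (map_roof C C (cx_id C))),
      Cmp = roof_comp n a\<rparr>"

text \<open>
  Cohomology on morphisms of the derived category: the roof \<open>(s, f)\<close> acts as
  \<open>H f \<circ> (H s)\<^sup>-\<^sup>1\<close>, and all roofs in a class act in the same way.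
\<close>

definition roof_cohom :: "(nat \<Rightarrow> bool) \<Rightarrow> int \<Rightarrow> 'k::field roof \<Rightarrow> 'k rmap" where
  "roof_cohom a i r =
     (THE m. m \<in> rep_hom a (cohom a i (rsrc r)) (cohom a i (rtgt r)) \<and>
             rep_comp m (cohom_map i (apex r) (rsrc r) (lleg r))
               = cohom_map i (apex r) (rtgt r) (rleg r))"

definition Db_cohom :: "(nat \<Rightarrow> bool) \<Rightarrow> int \<Rightarrow> 'k::field roof set \<Rightarrow> 'k rmap" where
  "Db_cohom a i \<phi> = roof_cohom a i (SOME r. r \<in> \<phi>)"


section \<open>The distances on the derived category of the equioriented quiver\<close>

definition derived_interleaved :: "nat \<Rightarrow> nat \<Rightarrow> 'k::field cx \<Rightarrow> 'k cx \<Rightarrow> bool" where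
  "derived_interleaved n \<delta> C D \<longleftrightarrow>
     (\<exists>\<phi>\<in>Mor (Db n equi) C (cx_shift n \<delta> D). \<exists>\<gamma>\<in>Mor (Db n equi) D (cx_shift n \<delta> C).
        \<forall>i. interleaving_pair n \<delta> (cohom equi i C) (cohom equi i D)
              (Db_cohom equi i \<phi>) (Db_cohom equi i \<gamma>))"

definition dI_D :: "nat \<Rightarrow> 'k::field cx \<Rightarrow> 'k cx \<Rightarrow> enat" where
  "dI_D n C D = Inf {enat \<delta> | \<delta>. derived_interleaved n \<delta> C D}"

text \<open>The disjoint union of the barcodes of the cohomologies is kept as a family over the degrees.\<close>

definition barcode_D :: "nat \<Rightarrow> 'k::field cx \<Rightarrow> int \<Rightarrow> (nat \<times> nat) multiset" where
  "barcode_D n C = (\<lambda>i. barcode n equi (cohom equi i C))"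

definition dB_D ::
  "(int \<Rightarrow> (nat \<times> nat) multiset) \<Rightarrow> (int \<Rightarrow> (nat \<times> nat) multiset) \<Rightarrow> enat" where
  "dB_D B B' = Inf {enat \<delta> | \<delta>. \<forall>i. \<exists>\<sigma>. is_matching \<delta> (B i) (B' i) \<sigma>}"


section \<open>Sections of the Auslander-Reiten quiver\<close>

definition split_mono :: "(nat \<Rightarrow> bool) \<Rightarrow> 'k::field rep \<Rightarrow> 'k rep \<Rightarrow> 'k rmap \<Rightarrow> bool" where
  "split_mono a M N f \<longleftrightarrow> (\<exists>g\<in>rep_hom a N M. rep_comp g f = rep_id M)"

definition split_epi :: "(nat \<Rightarrow> bool) \<Rightarrow> 'k::field rep \<Rightarrow> 'k rep \<Rightarrow> 'k rmap \<Rightarrow> bool" where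
  "split_epi a M N f \<longleftrightarrow> (\<exists>g\<in>rep_hom a N M. rep_comp f g = rep_id N)"

definition irreducible_map ::
  "nat \<Rightarrow> (nat \<Rightarrow> bool) \<Rightarrow> 'k::field rep \<Rightarrow> 'k rep \<Rightarrow> 'k rmap \<Rightarrow> bool" where
  "irreducible_map n a M N f \<longleftrightarrow> f \<in> rep_hom a M N \<and>
     \<not> split_mono a M N f \<and> \<not> split_epi a M N f \<and>
     (\<forall>L. is_rep n a L \<longrightarrow> (\<forall>g\<in>rep_hom a M L. \<forall>h\<in>rep_hom a L N.
        f = rep_comp h g \<longrightarrow> split_mono a M L g \<or> split_epi a L N h))"

definition short_exact ::
  "(nat \<Rightarrow> bool) \<Rightarrow> 'k::field rep \<Rightarrow> 'k rep \<Rightarrow> 'k rep \<Rightarrow> 'k rmap \<Rightarrow> 'k rmap \<Rightarrow> bool" where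
  "short_exact a L M N f g \<longleftrightarrow> f \<in> rep_hom a L M \<and> g \<in> rep_hom a M N \<and>
     (\<forall>x. mat_kernel (f x) = {0\<^sub>v (vdim L x)} \<and> mat_image (f x) = mat_kernel (g x) \<and>
          mat_image (g x) = carrier_vec (vdim N x))"

definition almost_split ::
  "nat \<Rightarrow> (nat \<Rightarrow> bool) \<Rightarrow> 'k::field rep \<Rightarrow> 'k rep \<Rightarrow> 'k rep \<Rightarrow> 'k rmap \<Rightarrow> 'k rmap \<Rightarrow> bool" where
  "almost_split n a L M N f g \<longleftrightarrow>
     is_rep n a L \<and> is_rep n a M \<and> is_rep n a N \<and> short_exact a L M N f g \<and>
     \<not> split_mono a L M f \<and>
     (\<forall>V. is_rep n a V \<longrightarrow> (\<forall>h\<in>rep_hom a L V. \<not> split_mono a L V h \<longrightarrow>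
        (\<exists>h'\<in>rep_hom a M V. h = rep_comp h' f))) \<and>
     \<not> split_epi a M N g \<and>
     (\<forall>V. is_rep n a V \<longrightarrow> (\<forall>h\<in>rep_hom a V N. \<not> split_epi a V N h \<longrightarrow>
        (\<exists>h'\<in>rep_hom a V M. h = rep_comp g h')))"

text \<open>
  The Auslander-Reiten translate of \<open>N\<close> is the left end of the almost split sequence ending
  in \<open>N\<close>. Vertices of the Auslander-Reiten quiver are isomorphism classes, hence orbits are
  closed under isomorphism.
\<close>

definition is_translate :: "nat \<Rightarrow> (nat \<Rightarrow> bool) \<Rightarrow> 'k::field rep \<Rightarrow> 'k rep \<Rightarrow> bool" where
  "is_translate n a L N \<longleftrightarrow> (\<exists>M f g. almost_split n a L M N f g)"

definition tau_orbit :: "nat \<Rightarrow> (nat \<Rightarrow> bool) \<Rightarrow> 'k::field rep \<Rightarrow> 'k rep set" where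
  "tau_orbit n a P = {M. is_rep n a M \<and>
     equivclp (\<lambda>L N. is_rep n a L \<and> is_rep n a N \<and>
                     (rep_isomorphic a L N \<or> is_translate n a L N)) P M}"

definition proj_rep :: "nat \<Rightarrow> nat \<Rightarrow> 'k::field rep" where
  "proj_rep n i = interval_rep equi (i, n)"

text \<open>
  Arrows of the Auslander-Reiten quiver of the equioriented quiver; this quiver has no multiple
  arrows.
\<close>

definition ar_arrow :: "nat \<Rightarrow> 'k::field rep \<Rightarrow> 'k rep \<Rightarrow> bool" where
  "ar_arrow n M N \<longleftrightarrow> (\<exists>f. irreducible_map n equi M N f)"

text \<open>A section, given by the family of its vertices \<open>S 1, \<dots>, S n\<close>.\<close>

definition is_section :: "nat \<Rightarrow> (nat \<Rightarrow> 'k::field rep) \<Rightarrow> bool" where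
  "is_section n S \<longleftrightarrow>
     (\<forall>i\<in>{1..n}. S i \<in> tau_orbit n equi (proj_rep n i)) \<and>
     (\<forall>i\<in>{1..n}. \<forall>j\<in>{1..n}.
        equivclp (\<lambda>p q. p \<in> {1..n} \<and> q \<in> {1..n} \<and> ar_arrow n (S p) (S q)) i j)"

text \<open>
  An isomorphism from the quiver with orientation \<open>a\<close> to the opposite of the section \<open>S\<close>,
  given by its bijection \<open>\<psi>\<close> on vertices.
\<close>

definition op_section_iso ::
  "nat \<Rightarrow> (nat \<Rightarrow> bool) \<Rightarrow> (nat \<Rightarrow> 'k::field rep) \<Rightarrow> (nat \<Rightarrow> nat) \<Rightarrow> bool" where
  "op_section_iso n a S \<psi> \<longleftrightarrow> bij_betw \<psi> {1..n} {1..n} \<and>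
     (\<forall>x\<in>{1..n}. \<forall>y\<in>{1..n}.
        (\<exists>i\<in>{1..<n}. asrc a i = x \<and> atgt a i = y) \<longleftrightarrow> ar_arrow n (S (\<psi> y)) (S (\<psi> x)))"

text \<open>
  The isomorphism between the path algebra of the opposite of the section and the opposite
  endomorphism algebra of the tilting module is given by a choice of irreducible morphisms
  representing the arrows of the section.
\<close>

definition arrow_choice ::
  "nat \<Rightarrow> (nat \<Rightarrow> bool) \<Rightarrow> (nat \<Rightarrow> 'k::field rep) \<Rightarrow> (nat \<Rightarrow> nat) \<Rightarrow> (nat \<Rightarrow> 'k rmap) \<Rightarrow> bool" where
  "arrow_choice n a S \<psi> \<alpha> \<longleftrightarrow>
     (\<forall>i\<in>{1..<n}. irreducible_map n equi (S (\<psi> (atgt a i))) (S (\<psi> (asrc a i))) (\<alpha> i))"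


section \<open>The functor represented by the tilting module\<close>

definition tilting :: "nat \<Rightarrow> (nat \<Rightarrow> 'k::field rep) \<Rightarrow> 'k rep" where
  "tilting n S = rep_dsum (map S [1..<n + 1])"

text \<open>The inclusion of the summand \<open>S j\<close> into \<open>tilting n S\<close>, and the projection onto it.\<close>

definition summand_inc :: "nat \<Rightarrow> (nat \<Rightarrow> 'k::field rep) \<Rightarrow> nat \<Rightarrow> 'k rmap" where
  "summand_inc n S j = (\<lambda>x. mat (vdim (tilting n S) x) (vdim (S j) x)
     (\<lambda>(p, q). if p = (\<Sum>l = 1..<j. vdim (S l) x) + q then 1 else 0))"

definition summand_proj :: "nat \<Rightarrow> (nat \<Rightarrow> 'k::field rep) \<Rightarrow> nat \<Rightarrow> 'k rmap" where
  "summand_proj n S j = (\<lambda>x. transpose_mat (summand_inc n S j x))"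

text \<open>The endomorphisms of the tilting module that correspond to the vertex \<open>x\<close> and the arrow \<open>i\<close>.\<close>

definition vertex_end :: "nat \<Rightarrow> (nat \<Rightarrow> 'k::field rep) \<Rightarrow> (nat \<Rightarrow> nat) \<Rightarrow> nat \<Rightarrow> 'k rmap" where
  "vertex_end n S \<psi> x = rep_comp (summand_inc n S (\<psi> x)) (summand_proj n S (\<psi> x))"

definition arrow_end ::
  "nat \<Rightarrow> (nat \<Rightarrow> bool) \<Rightarrow> (nat \<Rightarrow> 'k::field rep) \<Rightarrow> (nat \<Rightarrow> nat) \<Rightarrow> (nat \<Rightarrow> 'k rmap) \<Rightarrow>
   nat \<Rightarrow> 'k rmap" where
  "arrow_end n a S \<psi> \<alpha> i =
     rep_comp (summand_inc n S (\<psi> (asrc a i)))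
       (rep_comp (\<alpha> i) (summand_proj n S (\<psi> (atgt a i))))"

text \<open>
  Coordinates in a subspace \<open>V\<close> of the space of morphisms from \<open>M\<close> to \<open>N\<close>, with respect to a
  chosen basis.
\<close>

definition lin_comb :: "'k::field rep \<Rightarrow> 'k rep \<Rightarrow> 'k rmap list \<Rightarrow> 'k vec \<Rightarrow> 'k rmap" where
  "lin_comb M N bs c = (\<lambda>x. mat (vdim N x) (vdim M x)
     (\<lambda>pq. \<Sum>j<length bs. c $ j * (bs ! j) x $$ pq))"

definition hom_basis :: "'k::field rep \<Rightarrow> 'k rep \<Rightarrow> 'k rmap set \<Rightarrow> 'k rmap list" where
  "hom_basis M N V = (SOME bs. set bs \<subseteq> V \<and>
     (\<forall>h\<in>V. \<exists>!c. c \<in> carrier_vec (length bs) \<and> h = lin_comb M N bs c))"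

definition hom_coords :: "'k::field rep \<Rightarrow> 'k rep \<Rightarrow> 'k rmap set \<Rightarrow> 'k rmap \<Rightarrow> 'k vec" where
  "hom_coords M N V h =
     (THE c. c \<in> carrier_vec (length (hom_basis M N V)) \<and> h = lin_comb M N (hom_basis M N V) c)"

text \<open>
  \<open>Hom(T, M)\<close>, for \<open>T = tilting n S\<close>, as a left module over the opposite endomorphism algebra
  (acting by precomposition), written as a representation of the quiver with orientation \<open>a\<close>:
  the space at \<open>x\<close> is \<open>homT_at n S \<psi> M x\<close>, the image of the idempotent at \<open>x\<close>, and the arrow on
  edge \<open>i\<close> acts as precomposition with \<open>arrow_end n a S \<psi> \<alpha> i\<close>.
\<close>

definition homT_at ::
  "nat \<Rightarrow> (nat \<Rightarrow> 'k::field rep) \<Rightarrow> (nat \<Rightarrow> nat) \<Rightarrow> 'k rep \<Rightarrow> nat \<Rightarrow> 'k rmap set" where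
  "homT_at n S \<psi> M x =
     (\<lambda>h. rep_comp h (vertex_end n S \<psi> x)) ` rep_hom equi (tilting n S) M"

definition homT ::
  "nat \<Rightarrow> (nat \<Rightarrow> bool) \<Rightarrow> (nat \<Rightarrow> 'k::field rep) \<Rightarrow> (nat \<Rightarrow> nat) \<Rightarrow> (nat \<Rightarrow> 'k rmap) \<Rightarrow>
   'k rep \<Rightarrow> 'k rep" where
  "homT n a S \<psi> \<alpha> M =
     (let T = tilting n S; V = homT_at n S \<psi> M; bs = (\<lambda>x. hom_basis T M (V x));
          dm = (\<lambda>x. if x \<in> {1..n} then length (bs x) else 0)
      in \<lparr>vdim = dm,
          arr = (\<lambda>i. if i \<in> {1..<n}
                     then mat_of_cols (dm (atgt a i))
                            (map (\<lambda>h. hom_coords T M (V (atgt a i))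
                                        (rep_comp h (arrow_end n a S \<psi> \<alpha> i)))
                                 (bs (asrc a i)))
                     else 0\<^sub>m (dm (atgt a i)) (dm (asrc a i)))\<rparr>)"

definition homT_map ::
  "nat \<Rightarrow> (nat \<Rightarrow> 'k::field rep) \<Rightarrow> (nat \<Rightarrow> nat) \<Rightarrow> 'k rep \<Rightarrow> 'k rep \<Rightarrow> 'k rmap \<Rightarrow> 'k rmap" where
  "homT_map n S \<psi> M N g =
     (let T = tilting n S
      in (\<lambda>x. if x \<in> {1..n}
              then mat_of_cols (length (hom_basis T N (homT_at n S \<psi> N x)))
                     (map (\<lambda>h. hom_coords T N (homT_at n S \<psi> N x) (rep_comp g h))
                          (hom_basis T M (homT_at n S \<psi> M x)))
              else 0\<^sub>m 0 0))"

definition homT_cx ::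
  "nat \<Rightarrow> (nat \<Rightarrow> bool) \<Rightarrow> (nat \<Rightarrow> 'k::field rep) \<Rightarrow> (nat \<Rightarrow> nat) \<Rightarrow> (nat \<Rightarrow> 'k rmap) \<Rightarrow>
   'k cx \<Rightarrow> 'k cx" where
  "homT_cx n a S \<psi> \<alpha> C =
     \<lparr>deg = (\<lambda>i. homT n a S \<psi> \<alpha> (deg C i)),
      diff = (\<lambda>i. homT_map n S \<psi> (deg C i) (deg C (i + 1)) (diff C i))\<rparr>"

definition homT_cmap ::
  "nat \<Rightarrow> (nat \<Rightarrow> 'k::field rep) \<Rightarrow> (nat \<Rightarrow> nat) \<Rightarrow> 'k cx \<Rightarrow> 'k cx \<Rightarrow> 'k cmap \<Rightarrow> 'k cmap" where
  "homT_cmap n S \<psi> C D f = (\<lambda>i. homT_map n S \<psi> (deg C i) (deg D i) (f i))"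


section \<open>The derived functor and the transported distances\<close>

definition is_injective :: "nat \<Rightarrow> (nat \<Rightarrow> bool) \<Rightarrow> 'k::field rep \<Rightarrow> bool" where
  "is_injective n a J \<longleftrightarrow> is_rep n a J \<and>
     (\<forall>L M. is_rep n a L \<longrightarrow> is_rep n a M \<longrightarrow>
        (\<forall>f\<in>rep_hom a L M. \<forall>g\<in>rep_hom a L J.
           (\<forall>x. mat_kernel (f x) = {0\<^sub>v (vdim L x)}) \<longrightarrow> (\<exists>h\<in>rep_hom a M J. g = rep_comp h f)))"

definition is_inj_resolution ::
  "nat \<Rightarrow> (nat \<Rightarrow> bool) \<Rightarrow> 'k::field cx \<Rightarrow> 'k cx \<Rightarrow> 'k cmap \<Rightarrow> bool" where
  "is_inj_resolution n a C J \<iota> \<longleftrightarrow>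
     is_bounded_cx n a J \<and> (\<forall>i. is_injective n a (deg J i)) \<and> quasi_iso a C J \<iota>"

definition inj_res :: "nat \<Rightarrow> (nat \<Rightarrow> bool) \<Rightarrow> 'k::field cx \<Rightarrow> 'k cx \<times> 'k cmap" where
  "inj_res n a C = (SOME (J, \<iota>). is_inj_resolution n a C J \<iota>)"

text \<open>
  On a morphism represented by a roof \<open>(s, f)\<close> from \<open>C\<close> to \<open>D\<close>, the functor \<open>RHom(T, -)\<close> is
  \<open>Hom(T, g)\<close> for the lift \<open>g\<close> of the roof, unique up to homotopy, to injective resolutions
  \<open>(J, \<iota>)\<close> of \<open>C\<close> and \<open>(K, \<kappa>)\<close> of \<open>D\<close>, that is, \<open>g \<circ> \<iota> \<circ> s\<close> is homotopic to \<open>\<kappa> \<circ> f\<close>.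
\<close>

definition RHomT ::
  "nat \<Rightarrow> (nat \<Rightarrow> bool) \<Rightarrow> (nat \<Rightarrow> 'k::field rep) \<Rightarrow> (nat \<Rightarrow> nat) \<Rightarrow> (nat \<Rightarrow> 'k rmap) \<Rightarrow>
   ('k cx, 'k roof set, 'k cx, 'k roof set) func" where
  "RHomT n a S \<psi> \<alpha> =
     \<lparr>fob = (\<lambda>C. homT_cx n a S \<psi> \<alpha> (fst (inj_res n equi C))),
      fmor = (\<lambda>\<phi>. {t. \<exists>r\<in>\<phi>. \<exists>J \<iota> K \<kappa> g.
        inj_res n equi (rsrc r) = (J, \<iota>) \<and> inj_res n equi (rtgt r) = (K, \<kappa>) \<and>
        g \<in> cx_hom equi J K \<and>
        homotopic equi (apex r) K (cx_comp g (cx_comp \<iota> (lleg r))) (cx_comp \<kappa> (rleg r)) \<and>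
        t \<in> roof_class n a (map_roof (homT_cx n a S \<psi> \<alpha> J) (homT_cx n a S \<psi> \<alpha> K)
                             (homT_cmap n S \<psi> J K g))})\<rparr>"

type_synonym 'k Db_functor = "('k cx, 'k roof set, 'k cx, 'k roof set) func"

text \<open>
  The transported distances with respect to a quasi-inverse \<open>E\<close> of \<open>RHom(T, -)\<close>. The bottleneck
  distance is determined by the barcodes of \<open>X\<close> and \<open>Y\<close>, because these determine \<open>X\<close> and \<open>Y\<close> up
  to isomorphism.
\<close>

definition dI_T :: "nat \<Rightarrow> 'k::field Db_functor \<Rightarrow> 'k rep \<Rightarrow> 'k rep \<Rightarrow> enat" where
  "dI_T n E X Y = dI_D n (fob E (stalk X)) (fob E (stalk Y))"

definition dB_T :: "nat \<Rightarrow> 'k::field Db_functor \<Rightarrow> 'k rep \<Rightarrow> 'k rep \<Rightarrow> enat" where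
  "dB_T n E X Y =
     dB_D (barcode_D n (fob E (stalk X))) (barcode_D n (fob E (stalk Y)))"

end

theory Submission
  imports Defs
begin

text \<open>
  Both distances compare the complexes \<open>E X\<close> and \<open>E Y\<close> over the equioriented quiver, degree by
  degree in cohomology: a derived interleaving induces an interleaving pair between \<open>H\<^sup>i\<close> of the
  two complexes for every \<open>i\<close>, and the bottleneck distance asks for a matching between the
  barcodes of these same representations. So every \<open>\<delta>\<close> that is admissible for the interleaving
  distance is admissible for the bottleneck distance, provided that algebraic stability holds
  for representations of the equioriented quiver: a \<open>\<delta>\<close>-interleaving yields a \<open>\<delta>\<close>-matching of
  barcodes (\<open>algebraic_stability\<close>).

  Stability is proved by Bjerkevik's argument. Written in bases adapted to the interval
  decompositions, an interleaving is a pair of families of scalars, one for each pair of bars. The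
  composite of the two maps is a structure map; so on the bars \<open>\<langle>b, d\<rangle>\<close> with \<open>d - b \<ge> 2\<delta>\<close>,
  ordered by \<open>b + d\<close>, it is triangular with ones on the diagonal, even if only the
  intermediate bars \<open>\<delta>\<close>-close to one of the given bars are kept. A matrix of rank \<open>r\<close> needs
  at least \<open>r\<close> intermediate indices, which is Hall's condition for matching long bars to close
  bars (\<open>long_bars_hall_condition\<close>). Hall's theorem gives an injection for the long bars on each
  side, and these two are merged into a single matching (\<open>common_matching\<close>).

  The barcode is defined by a definite description, so interval decompositions must be shown to
  exist and to be unique. Existence (\<open>bar_basis_exists\<close>): at the first vertex where a natural
  idempotent is nonzero, any nonzero vector of its image generates an interval summand. Uniqueness
  (\<open>bar_basis_unique\<close>) is stability for the identity, an interleaving with \<open>\<delta> = 0\<close>. Finally, the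
  cohomology of a bounded complex, formed with chosen projections, has to be a representation
  (\<open>cohom_is_rep\<close>).
\<close>

section \<open>Matchings in bipartite relations\<close>

text \<open>
  The Halmos-Vaughan induction. If some proper nonempty \<open>S\<close> is tight, it is matched first and the
  rest avoids the neighbours of \<open>S\<close>; otherwise any element may be matched arbitrarily, since all
  remaining sets have a spare neighbour.
\<close>

lemma hall_marriage:
  fixes N :: "'a \<Rightarrow> 'b set"
  assumes "finite A" and "\<And>a. a \<in> A \<Longrightarrow> finite (N a)"
    and "\<And>S. S \<subseteq> A \<Longrightarrow> card S \<le> card (\<Union>(N ` S))"
  shows "\<exists>f. inj_on f A \<and> (\<forall>a\<in>A. f a \<in> N a)"
  using assms
proof (induction "card A" arbitrary: A N rule: less_induct)
  case (less A N)
  note finA = less.prems(1) and finN = less.prems(2) and hall = less.prems(3)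
  have finU: "finite (\<Union>(N ` S))" if "S \<subseteq> A" for S
    using that finA finN by (meson finite_UN_I finite_subset subsetD)
  consider "A = {}" | "A \<noteq> {}" "\<exists>S. S \<subset> A \<and> S \<noteq> {} \<and> card (\<Union>(N ` S)) = card S"
    | "A \<noteq> {}" "\<And>S. S \<subset> A \<Longrightarrow> S \<noteq> {} \<Longrightarrow> card S < card (\<Union>(N ` S))"
    using hall by (metis nat_less_le psubset_imp_subset)
  then show ?case
  proof cases
    case 1
    then show ?thesis by simp
  next
    case 2
    then obtain S where S: "S \<subset> A" "S \<noteq> {}" and tight: "card (\<Union>(N ` S)) = card S"
      by blast
    define U where "U = \<Union>(N ` S)"
    have finS: "finite S" using S finA finite_subset by blast
    have "\<exists>f. inj_on f S \<and> (\<forall>a\<in>S. f a \<in> N a)"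
      using S by (intro less.hyps psubset_card_mono finA finS finN hall) auto
    then obtain f where f: "inj_on f S" "\<forall>a\<in>S. f a \<in> N a" by blast
    have "\<exists>g. inj_on g (A - S) \<and> (\<forall>a\<in>A - S. g a \<in> N a - U)"
    proof (rule less.hyps)
      show "card (A - S) < card A"
        by (rule psubset_card_mono) (use S finA in auto)
      fix R assume R: "R \<subseteq> A - S"
      have "card R + card S = card (R \<union> S)"
        using R finS finite_subset[OF R] finA by (intro card_Un_disjoint[symmetric]) auto
      also have "\<dots> \<le> card (\<Union>(N ` (R \<union> S)))"
        using R S by (intro hall) auto
      also have "\<Union>(N ` (R \<union> S)) = (\<Union>a\<in>R. N a - U) \<union> U"
        unfolding U_def by auto
      also have "card \<dots> \<le> card (\<Union>a\<in>R. N a - U) + card U"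
        by (rule card_Un_le)
      finally show "card R \<le> card (\<Union>a\<in>R. N a - U)"
        using tight U_def by simp
    qed (use finA finN in auto)
    then obtain g where g: "inj_on g (A - S)" "\<forall>a\<in>A - S. g a \<in> N a - U" by blast
    have "f a \<in> U" if "a \<in> S" for a using f(2) that U_def by auto
    then have "inj_on (\<lambda>a. if a \<in> S then f a else g a) A"
      using f(1) g unfolding inj_on_def by (metis Diff_iff)
    then show ?thesis using f(2) g(2) by (intro exI[of _ "\<lambda>a. if a \<in> S then f a else g a"]) auto
  next
    case 3
    then obtain a where a: "a \<in> A" by blast
    have "card {a} \<le> card (\<Union>(N ` {a}))" using a by (intro hall) auto
    then obtain b where b: "b \<in> N a" by (cases "N a = {}") auto
    have "\<exists>g. inj_on g (A - {a}) \<and> (\<forall>c\<in>A - {a}. g c \<in> N c - {b})"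
    proof (rule less.hyps)
      show "card (A - {a}) < card A" using a finA by (rule card_Diff1_less[rotated])
      fix R assume R: "R \<subseteq> A - {a}"
      show "card R \<le> card (\<Union>c\<in>R. N c - {b})"
      proof (cases "R = {}")
        case False
        then have "card R < card (\<Union>(N ` R))" using 3(2)[of R] R a by blast
        moreover have "(\<Union>c\<in>R. N c - {b}) = \<Union>(N ` R) - {b}" by auto
        moreover have "card (\<Union>(N ` R)) \<le> Suc (card (\<Union>(N ` R) - {b}))"
          using card_Un_le[of "\<Union>(N ` R) - {b}" "{b}"] finU[of R] R
          by (cases "b \<in> \<Union>(N ` R)") (simp_all add: insert_absorb)
        ultimately show ?thesis by simp
      qed simp
    qed (use finA finN in auto)
    then obtain g where g: "inj_on g (A - {a})" "\<forall>c\<in>A - {a}. g c \<in> N c - {b}" by blast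
    then have "inj_on (g(a := b)) A"
      unfolding inj_on_def by (metis Diff_iff fun_upd_apply singletonI singletonD)
    then show ?thesis using g(2) b by (intro exI[of _ "g(a := b)"]) auto
  qed
qed

text \<open>
  The theorem of Mendelsohn and Dulmage, by the fixed point of the Schroeder-Bernstein theorem:
  \<open>s\<close> is used on the part \<open>X\<close> of \<open>A\<close>, and \<open>t\<close> on the elements of \<open>B\<close> that \<open>s\<close> does not reach
  from \<open>X\<close>.
\<close>

lemma common_matching:
  fixes s :: "'a \<Rightarrow> 'b" and t :: "'b \<Rightarrow> 'a"
  assumes s: "inj_on s A" "\<And>a. a \<in> A \<Longrightarrow> a \<in> A' \<and> s a \<in> B' \<and> R a (s a)"
    and t: "inj_on t B" "\<And>b. b \<in> B \<Longrightarrow> b \<in> B' \<and> t b \<in> A' \<and> R (t b) b"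
  obtains m where "m \<subseteq> A' \<times> B'" "\<And>a b. (a, b) \<in> m \<Longrightarrow> R a b" "inj_on fst m" "inj_on snd m"
    "A \<subseteq> fst ` m" "B \<subseteq> snd ` m"
proof -
  define X where "X = lfp (\<lambda>X. A - t ` (B - s ` X))"
  have X: "X = A - t ` (B - s ` X)"
    unfolding X_def by (intro lfp_unfold monoI) blast
  define Y where "Y = B - s ` X"
  define m where "m = (\<lambda>a. (a, s a)) ` X \<union> (\<lambda>b. (t b, b)) ` Y"
  have XA: "X \<subseteq> A" and YB: "Y \<subseteq> B" and disj: "X \<inter> t ` Y = {}" "s ` X \<inter> Y = {}"
    using X Y_def by auto
  show ?thesis
  proof
    show "m \<subseteq> A' \<times> B'" using s(2) t(2) XA YB by (auto simp: m_def)
    show "R a b" if "(a, b) \<in> m" for a b using that s(2) t(2) XA YB by (auto simp: m_def)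
    show "inj_on fst m"
    proof (rule inj_onI)
      fix p q assume "p \<in> m" "q \<in> m" "fst p = fst q"
      then show "p = q"
        using disj(1) inj_on_subset[OF t(1) YB] unfolding m_def by (auto dest: inj_onD)
    qed
    show "inj_on snd m"
    proof (rule inj_onI)
      fix p q assume "p \<in> m" "q \<in> m" "snd p = snd q"
      then show "p = q"
        using disj(2) inj_on_subset[OF s(1) XA] unfolding m_def by (auto dest: inj_onD)
    qed
    have fst: "fst ` m = X \<union> t ` Y" and snd: "snd ` m = s ` X \<union> Y"
      by (simp_all add: m_def image_Un image_image)
    show "A \<subseteq> fst ` m" unfolding fst using X Y_def by blast
    show "B \<subseteq> snd ` m" unfolding snd Y_def by blast
  qed
qed

section \<open>Maps between sums of intervals, in coordinates\<close>

text \<open>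
  Gaussian elimination: the induction removes one equation together with a pivot unknown.
\<close>

lemma homogeneous_system_nontrivial_solution:
  fixes F :: "'b \<Rightarrow> 'a \<Rightarrow> 'k::field"
  assumes "finite B" "finite A" "card B < card A"
  shows "\<exists>c. (\<exists>a\<in>A. c a \<noteq> 0) \<and> (\<forall>b\<in>B. (\<Sum>a\<in>A. F b a * c a) = 0)"
  using assms
proof (induction B arbitrary: A F rule: finite_induct)
  case empty
  then have "A \<noteq> {}" by auto
  then show ?case by (intro exI[of _ "\<lambda>_. 1"]) auto
next
  case (insert b B A F)
  show ?case
  proof (cases "\<forall>a\<in>A. F b a = 0")
    case True
    have "card B < card A" using insert by simp
    then obtain c where "\<exists>a\<in>A. c a \<noteq> 0" "\<forall>b\<in>B. (\<Sum>a\<in>A. F b a * c a) = 0"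
      using insert.IH[of A F] insert.prems by blast
    then show ?thesis using True by (intro exI[of _ c]) auto
  next
    case False
    then obtain p where p: "p \<in> A" "F b p \<noteq> 0" by blast
    define A' where "A' = A - {p}"
    have A: "A = insert p A'" "p \<notin> A'" and fin: "finite A'"
      using p insert.prems by (auto simp: A'_def)
    have "card B < card A'" using insert A fin by simp
    then obtain c where c: "\<exists>a\<in>A'. c a \<noteq> 0"
        "\<forall>e\<in>B. (\<Sum>a\<in>A'. (F e a - F e p * F b a / F b p) * c a) = 0"
      using insert.IH[of A' "\<lambda>e a. F e a - F e p * F b a / F b p"] fin by blast
    define c' where "c' = c(p := - (\<Sum>a\<in>A'. F b a * c a) / F b p)"
    have sum: "(\<Sum>a\<in>A. F e a * c' a) = (\<Sum>a\<in>A'. (F e a - F e p * F b a / F b p) * c a)" for e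
    proof -
      have "(\<Sum>a\<in>A'. F e a * c' a) = (\<Sum>a\<in>A'. F e a * c a)"
        using A(2) by (intro sum.cong) (auto simp: c'_def)
      then have "(\<Sum>a\<in>A. F e a * c' a) = (\<Sum>a\<in>A'. F e a * c a) - F e p * (\<Sum>a\<in>A'. F b a * c a) / F b p"
        using A fin by (simp add: c'_def)
      also have "\<dots> = (\<Sum>a\<in>A'. (F e a - F e p * F b a / F b p) * c a)"
        by (simp add: sum_subtractf left_diff_distrib sum_distrib_left sum_divide_distrib mult.assoc)
      finally show ?thesis .
    qed
    have "\<exists>a\<in>A. c' a \<noteq> 0" using c(1) A by (auto simp: c'_def)
    moreover have "\<forall>e\<in>insert b B. (\<Sum>a\<in>A. F e a * c' a) = 0"
      using c(2) p(2) by (simp add: sum)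
    ultimately show ?thesis by blast
  qed
qed

definition alive :: "nat \<times> nat \<Rightarrow> nat \<Rightarrow> bool" where
  "alive I x \<longleftrightarrow> fst I \<le> x \<and> x \<le> snd I"

definition bar :: "nat \<Rightarrow> nat \<times> nat \<Rightarrow> bool" where
  "bar n I \<longleftrightarrow> 1 \<le> fst I \<and> fst I \<le> snd I \<and> snd I \<le> n"

definition close :: "nat \<Rightarrow> nat \<times> nat \<Rightarrow> nat \<times> nat \<Rightarrow> bool" where
  "close \<delta> I J \<longleftrightarrow> fst I \<le> fst J + \<delta> \<and> fst J \<le> fst I + \<delta> \<and> snd I \<le> snd J + \<delta> \<and> snd J \<le> snd I + \<delta>"

text \<open>
  The scalars of a morphism from the sum of the bars \<open>xs\<close> to the \<open>\<delta>\<close>-shift of the sum of the bars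
  \<open>ys\<close>: \<open>F x k j\<close> is the coefficient at vertex \<open>x\<close> from bar \<open>j\<close> to bar \<open>k\<close>. The second condition is
  the naturality square of the edge \<open>x\<close>; both of its sides have a factor because a structure map
  of an interval is the identity or zero.
\<close>

definition bar_map :: "nat \<Rightarrow> (nat \<times> nat) list \<Rightarrow> (nat \<times> nat) list \<Rightarrow> (nat \<Rightarrow> nat \<Rightarrow> nat \<Rightarrow> 'k::field) \<Rightarrow> bool" where
  "bar_map \<delta> xs ys F \<longleftrightarrow> (\<forall>x\<ge>1. \<forall>j<length xs. \<forall>k<length ys.
     (F x k j \<noteq> 0 \<longrightarrow> alive (xs ! j) x \<and> alive (ys ! k) (x + \<delta>)) \<and>
     of_bool (alive (xs ! j) x) * F (x + 1) k j = of_bool (alive (ys ! k) (x + 1 + \<delta>)) * F x k j)"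

lemma bar_map_support:
  assumes "bar_map \<delta> xs ys F" "1 \<le> x" "j < length xs" "k < length ys" "F x k j \<noteq> 0"
  shows "alive (xs ! j) x" "alive (ys ! k) (x + \<delta>)"
  using assms unfolding bar_map_def by blast+

lemma bar_map_step:
  assumes "bar_map \<delta> xs ys F" "1 \<le> x" "j < length xs" "k < length ys"
  shows "alive (xs ! j) x \<Longrightarrow> \<not> alive (ys ! k) (x + 1 + \<delta>) \<Longrightarrow> F (x + 1) k j = 0"
    "\<not> alive (xs ! j) x \<Longrightarrow> alive (ys ! k) (x + 1 + \<delta>) \<Longrightarrow> F x k j = 0"
    "alive (xs ! j) x \<Longrightarrow> alive (ys ! k) (x + 1 + \<delta>) \<Longrightarrow> F (x + 1) k j = F x k j"
proof -
  have "of_bool (alive (xs ! j) x) * F (x + 1) k j = of_bool (alive (ys ! k) (x + 1 + \<delta>)) * F x k j"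
    using assms unfolding bar_map_def by blast
  then show "alive (xs ! j) x \<Longrightarrow> \<not> alive (ys ! k) (x + 1 + \<delta>) \<Longrightarrow> F (x + 1) k j = 0"
    "\<not> alive (xs ! j) x \<Longrightarrow> alive (ys ! k) (x + 1 + \<delta>) \<Longrightarrow> F x k j = 0"
    "alive (xs ! j) x \<Longrightarrow> alive (ys ! k) (x + 1 + \<delta>) \<Longrightarrow> F (x + 1) k j = F x k j"
    by simp_all
qed

text \<open>
  A morphism between intervals is determined by its value at the birth of the source.
\<close>

lemma bar_map_propagates:
  assumes F: "bar_map \<delta> xs ys F" and j: "j < length xs" and k: "k < length ys"
    and J: "bar n (xs ! j)" and x: "fst (xs ! j) \<le> x"
  shows "F x k j = of_bool (x \<le> snd (xs ! j) \<and> x + \<delta> \<le> snd (ys ! k)) * F (fst (xs ! j)) k j"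
  using x
proof (induction x rule: dec_induct)
  case base
  have 1: "1 \<le> fst (xs ! j)" using J by (simp add: bar_def)
  show ?case
    using bar_map_support[OF F 1 j k]
    by (cases "F (fst (xs ! j)) k j = 0") (simp_all add: alive_def)
next
  case (step x)
  have x1: "1 \<le> x" and b1: "1 \<le> fst (xs ! j)" using J step(1) by (simp_all add: bar_def)
  show ?case
  proof (cases "x < snd (xs ! j) \<and> x + \<delta> < snd (ys ! k)")
    case False
    then have "F (Suc x) k j = 0"
      using bar_map_support[OF F _ j k, of "Suc x"] unfolding alive_def
      by (cases "F (Suc x) k j = 0") auto
    then show ?thesis using False by auto
  next
    case True
    then have a: "alive (xs ! j) x" using step(1) by (simp add: alive_def)
    have IH: "F x k j = F (fst (xs ! j)) k j" using step.IH True by simp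
    have "F (Suc x) k j = F (fst (xs ! j)) k j"
    proof (cases "fst (ys ! k) \<le> x + 1 + \<delta>")
      case le: True
      then have "alive (ys ! k) (x + 1 + \<delta>)" using True by (simp add: alive_def)
      then show ?thesis using bar_map_step(3)[OF F x1 j k a] IH by simp
    next
      case gt: False
      then have "\<not> alive (ys ! k) (x + 1 + \<delta>)" by (simp add: alive_def)
      then have "F (Suc x) k j = 0" using bar_map_step(1)[OF F x1 j k a] by simp
      moreover have "F (fst (xs ! j)) k j = 0"
        using bar_map_support(2)[OF F b1 j k] gt step(1) unfolding alive_def by fastforce
      ultimately show ?thesis by simp
    qed
    then show ?thesis using True by simp
  qed
qed

text \<open>
  Of the conditions for a nonzero morphism \<open>\<langle>b, d\<rangle> \<rightarrow> \<langle>b' - \<delta>, d' - \<delta>\<rangle>\<close>, the last one is due to the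
  fact that a target outliving the source would make the naturality square at the death of the
  source fail.
\<close>

lemma bar_map_nonzero:
  assumes F: "bar_map \<delta> xs ys F" and j: "j < length xs" and k: "k < length ys"
    and J: "bar n (xs ! j)" and nz: "F (fst (xs ! j)) k j \<noteq> 0"
  shows "fst (ys ! k) \<le> fst (xs ! j) + \<delta>" "fst (xs ! j) + \<delta> \<le> snd (ys ! k)"
    "snd (ys ! k) \<le> snd (xs ! j) + \<delta>"
proof -
  define d where "d = snd (xs ! j)"
  have bd: "1 \<le> fst (xs ! j)" "fst (xs ! j) \<le> d" "1 \<le> d" using J by (auto simp: bar_def d_def)
  show 1: "fst (ys ! k) \<le> fst (xs ! j) + \<delta>" "fst (xs ! j) + \<delta> \<le> snd (ys ! k)"
    using bar_map_support(2)[OF F bd(1) j k nz] by (simp_all add: alive_def)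
  show "snd (ys ! k) \<le> snd (xs ! j) + \<delta>"
  proof (rule ccontr)
    assume "\<not> ?thesis"
    then have long: "d + 1 + \<delta> \<le> snd (ys ! k)" by (simp add: d_def)
    have "F d k j = F (fst (xs ! j)) k j"
      using bar_map_propagates[OF F j k J bd(2)] long by (simp add: d_def)
    moreover have "F (d + 1) k j = F d k j"
      using bd 1 long by (intro bar_map_step(3)[OF F bd(3) j k]) (auto simp: alive_def d_def)
    moreover have "F (d + 1) k j = 0"
      using bar_map_support(1)[OF F _ j k, of "d + 1"] unfolding alive_def d_def by fastforce
    ultimately show False using nz by simp
  qed
qed

text \<open>
  The first six conditions are those of nonzero morphisms \<open>J \<rightarrow> K \<rightarrow> I\<close>, each of degree \<open>\<delta>\<close>.
  If \<open>K\<close> is close to neither end, then in each of the four cases the sum of the end points of \<open>I\<close> is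
  smaller than that of \<open>J\<close>.
\<close>

lemma close_of_path:
  assumes "fst K \<le> fst J + \<delta>" "fst J + \<delta> \<le> snd K" "snd K \<le> snd J + \<delta>"
    and "fst I \<le> fst K + \<delta>" "fst K + \<delta> \<le> snd I" "snd I \<le> snd K + \<delta>"
    and "fst J + snd J \<le> fst I + snd I"
  shows "close \<delta> J K \<or> close \<delta> I K"
  using assms unfolding close_def by linarith

text \<open>
  In coordinates: the composite of the two morphisms is the structure map of the sum of the bars
  \<open>xs\<close>, which maps a bar identically to itself as long as it is alive.
\<close>

definition composite_is_shift where
  "composite_is_shift \<delta> xs ys F G \<longleftrightarrow> (\<forall>x\<ge>1. \<forall>i<length xs. \<forall>j<length xs.
     (\<Sum>k<length ys. G (x + \<delta>) i k * F x k j)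
       = of_bool (i = j \<and> alive (xs ! j) x \<and> alive (xs ! j) (x + 2 * \<delta>)))"

text \<open>
  On \<open>S\<close>, ordered by \<open>b + d\<close>, the composite of \<open>F\<close> and \<open>G\<close> is triangular with ones on the
  diagonal. By \<open>close_of_path\<close>, the entries with source not above the target in this order only
  involve intermediate bars that are close to an element of \<open>S\<close>. If there were fewer than \<open>card S\<close> of them, a nontrivial combination
  of the columns would vanish on all of them, against triangularity.
\<close>

lemma long_bars_hall_condition:
  fixes F G :: "nat \<Rightarrow> nat \<Rightarrow> nat \<Rightarrow> 'k::field"
  assumes F: "bar_map \<delta> xs ys F" and G: "bar_map \<delta> ys xs G"
    and GF: "composite_is_shift \<delta> xs ys F G"
    and xs: "\<And>j. j < length xs \<Longrightarrow> bar n (xs ! j)" and ys: "\<And>k. k < length ys \<Longrightarrow> bar n (ys ! k)"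
    and S: "S \<subseteq> {..<length xs}" and long: "\<And>j. j \<in> S \<Longrightarrow> fst (xs ! j) + 2 * \<delta> \<le> snd (xs ! j)"
  shows "card S \<le> card (\<Union>j\<in>S. {k. k < length ys \<and> close \<delta> (xs ! j) (ys ! k)})"
proof (rule ccontr)
  define U where "U = (\<Union>j\<in>S. {k. k < length ys \<and> close \<delta> (xs ! j) (ys ! k)})"
  define \<phi> where "\<phi> k j = F (fst (xs ! j)) k j" for k j
  define \<gamma> where "\<gamma> i k = G (fst (ys ! k)) i k" for i k
  \<comment> \<open>Twice the midpoint of the bar, by which the triangular matrix is ordered.\<close>
  define mid where "mid i = fst (xs ! i) + snd (xs ! i)" for i
  have U: "U \<subseteq> {..<length ys}" by (auto simp: U_def)
  have finS: "finite S" and finU: "finite U" using S U finite_subset by blast+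
  have triangular: "(\<Sum>k\<in>U. \<gamma> i k * \<phi> k j) = of_bool (i = j)"
    if i: "i \<in> S" and j: "j \<in> S" and ij: "mid j \<le> mid i" for i j
  proof -
    have ij': "i < length xs" "j < length xs" using i j S by auto
    have b1: "1 \<le> fst (xs ! j)" using xs[OF ij'(2)] by (simp add: bar_def)
    \<comment> \<open>Otherwise \<open>d\<^sub>i < b\<^sub>j + 2\<delta> \<le> d\<^sub>j\<close> and \<open>b\<^sub>i \<le> d\<^sub>i - 2\<delta> < b\<^sub>j\<close>, against the order of \<open>i\<close> and \<open>j\<close>.\<close>
    have reach: "fst (xs ! j) + 2 * \<delta> \<le> snd (xs ! i)"
      using long[OF i] long[OF j] ij unfolding mid_def by linarith
    have "(\<Sum>k\<in>U. \<gamma> i k * \<phi> k j) = (\<Sum>k<length ys. \<gamma> i k * \<phi> k j)"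
    proof (rule sum.mono_neutral_left)
      show "\<forall>k\<in>{..<length ys} - U. \<gamma> i k * \<phi> k j = 0"
      proof (rule ballI, rule ccontr)
        fix k assume k: "k \<in> {..<length ys} - U" and "\<gamma> i k * \<phi> k j \<noteq> 0"
        then have nz: "\<gamma> i k \<noteq> 0" "\<phi> k j \<noteq> 0" and kl: "k < length ys" by auto
        have "close \<delta> (xs ! j) (ys ! k) \<or> close \<delta> (xs ! i) (ys ! k)"
          using bar_map_nonzero[OF F ij'(2) kl xs[OF ij'(2)] nz(2)[unfolded \<phi>_def]]
            bar_map_nonzero[OF G kl ij'(1) ys[OF kl] nz(1)[unfolded \<gamma>_def]] ij[unfolded mid_def]
          by (rule close_of_path)
        then show False using k i j by (auto simp: U_def)
      qed
    qed (use U in auto)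
    \<comment> \<open>The composite is evaluated at the birth of \<open>j\<close>, where \<open>G\<close> still has its initial coefficients.\<close>
    also have "\<dots> = (\<Sum>k<length ys. G (fst (xs ! j) + \<delta>) i k * F (fst (xs ! j)) k j)"
    proof (rule sum.cong[OF refl])
      fix k assume "k \<in> {..<length ys}"
      then have kl: "k < length ys" by simp
      show "\<gamma> i k * \<phi> k j = G (fst (xs ! j) + \<delta>) i k * F (fst (xs ! j)) k j"
      proof (cases "\<phi> k j = 0")
        case False
        note nz = bar_map_nonzero[OF F ij'(2) kl xs[OF ij'(2)] False[unfolded \<phi>_def]]
        show ?thesis
          using bar_map_propagates[OF G kl ij'(1) ys[OF kl] nz(1)] nz(2) reach
          by (simp add: \<phi>_def \<gamma>_def)
      qed (simp add: \<phi>_def)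
    qed
    also have "\<dots> = of_bool (i = j)"
    proof -
      have "alive (xs ! j) (fst (xs ! j))" "alive (xs ! j) (fst (xs ! j) + 2 * \<delta>)"
        using long[OF j] by (simp_all add: alive_def)
      moreover have "(\<Sum>k<length ys. G (fst (xs ! j) + \<delta>) i k * F (fst (xs ! j)) k j)
          = of_bool (i = j \<and> alive (xs ! j) (fst (xs ! j)) \<and> alive (xs ! j) (fst (xs ! j) + 2 * \<delta>))"
        using GF ij' b1 unfolding composite_is_shift_def by blast
      ultimately show ?thesis by simp
    qed
    finally show ?thesis .
  qed
  assume "\<not> ?thesis"
  then have "card U < card S" by (simp add: U_def)
  then obtain c where c: "\<exists>j\<in>S. c j \<noteq> 0" "\<forall>k\<in>U. (\<Sum>j\<in>S. \<phi> k j * c j) = 0"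
    using homogeneous_system_nontrivial_solution[OF finU finS] by blast
  have "\<exists>i. i \<in> S \<and> c i \<noteq> 0 \<and> (\<forall>j\<in>S. c j \<noteq> 0 \<longrightarrow> mid j \<le> mid i)"
  proof -
    have "finite (mid ` {j\<in>S. c j \<noteq> 0})" "mid ` {j\<in>S. c j \<noteq> 0} \<noteq> {}" using finS c(1) by auto
    then have "Max (mid ` {j\<in>S. c j \<noteq> 0}) \<in> mid ` {j\<in>S. c j \<noteq> 0}" by (rule Max_in)
    then obtain i where "i \<in> {j\<in>S. c j \<noteq> 0}" "mid i = Max (mid ` {j\<in>S. c j \<noteq> 0})"
      by (metis (no_types, lifting) imageE)
    then show ?thesis using finS by (intro exI[of _ i]) auto
  qed
  then obtain i where i: "i \<in> S" "c i \<noteq> 0" "\<And>j. j \<in> S \<Longrightarrow> c j \<noteq> 0 \<Longrightarrow> mid j \<le> mid i" by blast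
  have "0 = (\<Sum>k\<in>U. \<gamma> i k * (\<Sum>j\<in>S. \<phi> k j * c j))" using c(2) by simp
  also have "\<dots> = (\<Sum>j\<in>S. (\<Sum>k\<in>U. \<gamma> i k * \<phi> k j) * c j)"
    unfolding sum_distrib_left sum_distrib_right by (subst sum.swap) (simp add: mult.assoc)
  also have "\<dots> = (\<Sum>j\<in>S. of_bool (i = j) * c j)"
  proof (rule sum.cong[OF refl])
    fix j assume "j \<in> S"
    then show "(\<Sum>k\<in>U. \<gamma> i k * \<phi> k j) * c j = of_bool (i = j) * c j"
      using triangular[OF i(1)] i(3) by (cases "c j = 0") simp_all
  qed
  also have "\<dots> = c i" using i(1) finS by simp
  finally show False using i(2) by simp
qed

text \<open>
  Hall's theorem is applied to the long bars on each side separately; the two injections may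
  disagree, and \<open>common_matching\<close> reconciles them. Working with indices rather than bars takes
  care of multiplicities.
\<close>

lemma bar_maps_imp_matching:
  fixes F G :: "nat \<Rightarrow> nat \<Rightarrow> nat \<Rightarrow> 'k::field"
  assumes F: "bar_map \<delta> xs ys F" and G: "bar_map \<delta> ys xs G"
    and GF: "composite_is_shift \<delta> xs ys F G" and FG: "composite_is_shift \<delta> ys xs G F"
    and xs: "\<And>j. j < length xs \<Longrightarrow> bar n (xs ! j)" and ys: "\<And>k. k < length ys \<Longrightarrow> bar n (ys ! k)"
  shows "\<exists>\<sigma>. is_matching \<delta> (mset xs) (mset ys) \<sigma>"
proof -
  define long where "long zs = {j. j < length zs \<and> fst (zs ! j) + 2 * \<delta> \<le> snd (zs ! j)}" for zs :: "(nat \<times> nat) list"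
  have "\<exists>s. inj_on s (long xs) \<and> (\<forall>j\<in>long xs. s j \<in> {k. k < length ys \<and> close \<delta> (xs ! j) (ys ! k)})"
  proof (rule hall_marriage)
    fix S assume "S \<subseteq> long xs"
    then show "card S \<le> card (\<Union>j\<in>S. {k. k < length ys \<and> close \<delta> (xs ! j) (ys ! k)})"
      by (intro long_bars_hall_condition[OF F G GF xs ys]) (auto simp: long_def)
  qed (simp_all add: long_def)
  then obtain s where s: "inj_on s (long xs)" "\<And>j. j \<in> long xs \<Longrightarrow> s j < length ys \<and> close \<delta> (xs ! j) (ys ! s j)"
    by blast
  have "\<exists>t. inj_on t (long ys) \<and> (\<forall>k\<in>long ys. t k \<in> {j. j < length xs \<and> close \<delta> (ys ! k) (xs ! j)})"
  proof (rule hall_marriage)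
    fix S assume "S \<subseteq> long ys"
    then show "card S \<le> card (\<Union>k\<in>S. {j. j < length xs \<and> close \<delta> (ys ! k) (xs ! j)})"
      by (intro long_bars_hall_condition[OF G F FG ys xs]) (auto simp: long_def)
  qed (simp_all add: long_def)
  then obtain t where t: "inj_on t (long ys)" "\<And>k. k \<in> long ys \<Longrightarrow> t k < length xs \<and> close \<delta> (ys ! k) (xs ! t k)"
    by blast
  obtain m where m: "m \<subseteq> {..<length xs} \<times> {..<length ys}" "\<And>j k. (j, k) \<in> m \<Longrightarrow> close \<delta> (xs ! j) (ys ! k)"
      "inj_on fst m" "inj_on snd m" "long xs \<subseteq> fst ` m" "long ys \<subseteq> snd ` m"
    by (rule common_matching[OF s(1) _ t(1), of "{..<length xs}" "{..<length ys}"
          "\<lambda>j k. close \<delta> (xs ! j) (ys ! k)"])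
       (use s(2) t(2) in \<open>auto simp: long_def close_def\<close>)
  have finm: "finite m" using m(1) finite_subset by blast
  define \<sigma> where "\<sigma> = image_mset (\<lambda>(j, k). (xs ! j, ys ! k)) (mset_set m)"
  have mset: "mset zs = image_mset ((!) zs) (mset_set {..<length zs})" for zs :: "(nat \<times> nat) list"
    by (metis map_nth mset_map mset_upt lessThan_atLeast0)
  have fst: "image_mset fst \<sigma> = image_mset ((!) xs) (mset_set (fst ` m))"
    by (simp add: \<sigma>_def multiset.map_comp case_prod_unfold comp_def flip: image_mset_mset_set[OF m(3)])
  have snd: "image_mset snd \<sigma> = image_mset ((!) ys) (mset_set (snd ` m))"
    by (simp add: \<sigma>_def multiset.map_comp case_prod_unfold comp_def flip: image_mset_mset_set[OF m(4)])
  have sub: "fst ` m \<subseteq> {..<length xs}" "snd ` m \<subseteq> {..<length ys}" using m(1) by auto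
  have unmatched: "mset zs - image_mset ((!) zs) (mset_set T) = image_mset ((!) zs) (mset_set ({..<length zs} - T))"
      and sub_mset: "image_mset ((!) zs) (mset_set T) \<subseteq># mset zs"
    if "T \<subseteq> {..<length zs}" for T and zs :: "(nat \<times> nat) list"
  proof -
    have "mset_set {..<length zs} = mset_set T + mset_set ({..<length zs} - T)"
      using that by (metis Diff_disjoint Diff_partition finite_Diff finite_lessThan finite_subset mset_set_Union)
    then have *: "mset zs = image_mset ((!) zs) (mset_set T) + image_mset ((!) zs) (mset_set ({..<length zs} - T))"
      unfolding mset by simp
    show "mset zs - image_mset ((!) zs) (mset_set T) = image_mset ((!) zs) (mset_set ({..<length zs} - T))"
      "image_mset ((!) zs) (mset_set T) \<subseteq># mset zs" unfolding * by simp_all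
  qed
  have short: "\<not> int d - int b \<ge> 2 * int \<delta>"
    if bd: "(b, d) \<in># mset zs - image_mset ((!) zs) (mset_set T)" and T: "T \<subseteq> {..<length zs}" "long zs \<subseteq> T"
    for b d zs T
  proof -
    obtain j where "j < length zs" "j \<notin> T" "zs ! j = (b, d)"
      using bd unfolding unmatched[OF T(1)] by auto
    then have "j \<notin> long zs" using T(2) by auto
    then show ?thesis using \<open>j < length zs\<close> \<open>zs ! j = (b, d)\<close> by (simp add: long_def)
  qed
  have "is_matching \<delta> (mset xs) (mset ys) \<sigma>"
    unfolding is_matching_def
  proof (intro conjI)
    show "image_mset fst \<sigma> \<subseteq># mset xs" "image_mset snd \<sigma> \<subseteq># mset ys"
      unfolding fst snd using sub by (auto intro: sub_mset)
    show "\<forall>(b, d)\<in>#mset xs - image_mset fst \<sigma>. \<not> int d - int b \<ge> 2 * int \<delta>"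
      using short[OF _ sub(1) m(5)] unfolding fst by blast
    show "\<forall>(b, d)\<in>#mset ys - image_mset snd \<sigma>. \<not> int d - int b \<ge> 2 * int \<delta>"
      using short[OF _ sub(2) m(6)] unfolding snd by blast
    show "\<forall>((b, d), (b', d'))\<in>#\<sigma>.
        int b' - int \<delta> \<le> int b \<and> b \<le> d \<and> d \<le> d' + \<delta> \<and>
        int b - int \<delta> \<le> int b' \<and> b' \<le> d' \<and> d' \<le> d + \<delta>"
    proof (safe)
      fix b d b' d' assume "((b, d), (b', d')) \<in># \<sigma>"
      then obtain j k where jk: "(j, k) \<in> m" "xs ! j = (b, d)" "ys ! k = (b', d')"
        using finm by (auto simp: \<sigma>_def)
      have "j < length xs" "k < length ys" using jk(1) m(1) by auto
      then have "b \<le> d" "b' \<le> d'" using xs ys jk by (metis bar_def fst_conv snd_conv)+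
      then show "int b' - int \<delta> \<le> int b" "b \<le> d" "d \<le> d' + \<delta>" "int b - int \<delta> \<le> int b'" "b' \<le> d'" "d' \<le> d + \<delta>"
        using m(2)[OF jk(1)] jk by (auto simp: close_def)
    qed
  qed
  then show ?thesis by blast
qed

section \<open>Bases of bars\<close>

text \<open>
  Associativity in terms of dimensions rather than carrier sets, so that the simplifier can
  discharge the side conditions.
\<close>

lemma mult_mat_assoc:
  "dim_col A = dim_row B \<Longrightarrow> dim_col B = dim_row C \<Longrightarrow> A * B * C = A * (B * C :: 'k::semiring_0 mat)"
  by (rule assoc_mult_mat) auto

lemma mult_one_mat: "dim_row A = m \<Longrightarrow> 1\<^sub>m m * A = (A :: 'k::semiring_1 mat)"
  and mult_mat_one: "dim_col A = m \<Longrightarrow> A * 1\<^sub>m m = (A :: 'k::semiring_1 mat)"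
  by auto

definition alive_mat :: "(nat \<times> nat) list \<Rightarrow> nat \<Rightarrow> 'k::field mat" where
  "alive_mat xs x = mat (length xs) (length xs) (\<lambda>(i, j). of_bool (i = j \<and> alive (xs ! j) x))"

lemma alive_mat_dim [simp]: "dim_row (alive_mat xs x) = length xs" "dim_col (alive_mat xs x) = length xs"
  by (simp_all add: alive_mat_def)

lemma mult_alive_mat:
  assumes "dim_col A = length xs"
  shows "A * alive_mat xs x = mat (dim_row A) (length xs) (\<lambda>(i, j). A $$ (i, j) * of_bool (alive (xs ! j) x))"
proof (rule eq_matI)
  fix i j assume ij: "i < dim_row (mat (dim_row A) (length xs) (\<lambda>(i, j). A $$ (i, j) * of_bool (alive (xs ! j) x)))"
    "j < dim_col (mat (dim_row A) (length xs) (\<lambda>(i, j). A $$ (i, j) * of_bool (alive (xs ! j) x)))"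
  then have "(A * alive_mat xs x) $$ (i, j)
      = (\<Sum>k<length xs. if k = j then A $$ (i, j) * of_bool (alive (xs ! j) x) else 0)"
    using assms by (auto simp: alive_mat_def scalar_prod_def lessThan_atLeast0 intro!: sum.cong)
  then show "(A * alive_mat xs x) $$ (i, j)
      = mat (dim_row A) (length xs) (\<lambda>(i, j). A $$ (i, j) * of_bool (alive (xs ! j) x)) $$ (i, j)"
    using ij by simp
qed (use assms in auto)

lemma alive_mat_mult:
  assumes "dim_row A = length xs"
  shows "alive_mat xs x * A = mat (length xs) (dim_col A) (\<lambda>(i, j). of_bool (alive (xs ! i) x) * A $$ (i, j))"
proof (rule eq_matI)
  fix i j assume ij: "i < dim_row (mat (length xs) (dim_col A) (\<lambda>(i, j). of_bool (alive (xs ! i) x) * A $$ (i, j)))"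
    "j < dim_col (mat (length xs) (dim_col A) (\<lambda>(i, j). of_bool (alive (xs ! i) x) * A $$ (i, j)))"
  then have "{0..<length xs} \<inter> {k. i = k \<and> alive (xs ! k) x} = (if alive (xs ! i) x then {i} else {})"
    by auto
  then show "(alive_mat xs x * A) $$ (i, j)
      = mat (length xs) (dim_col A) (\<lambda>(i, j). of_bool (alive (xs ! i) x) * A $$ (i, j)) $$ (i, j)"
    using ij assms by (simp add: alive_mat_def scalar_prod_def)
qed (use assms in auto)

text \<open>
  A family of interval summands of \<open>M\<close>: column \<open>j\<close> of \<open>V x\<close> is the basis vector of bar \<open>j\<close> at
  vertex \<open>x\<close>, and row \<open>j\<close> of \<open>L x\<close> is the coordinate functional of bar \<open>j\<close>; both are zero where the
  bar is not alive. All bars keep their index at all vertices, so that no renumbering is needed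
  along an arrow.
\<close>

definition bar_system :: "'k::field rep \<Rightarrow> (nat \<times> nat) list \<Rightarrow> 'k rmap \<Rightarrow> 'k rmap \<Rightarrow> bool" where
  "bar_system M xs V L \<longleftrightarrow> (\<forall>x.
     arr M x \<in> carrier_mat (vdim M (Suc x)) (vdim M x) \<and>
     V x \<in> carrier_mat (vdim M x) (length xs) \<and>
     L x \<in> carrier_mat (length xs) (vdim M x) \<and>
     L x * V x = alive_mat xs x \<and> V x * alive_mat xs x = V x \<and> alive_mat xs x * L x = L x \<and>
     arr M x * V x = V (Suc x) * alive_mat xs x \<and>
     L (Suc x) * arr M x = alive_mat xs (Suc x) * L x)"

definition bar_basis :: "'k::field rep \<Rightarrow> (nat \<times> nat) list \<Rightarrow> 'k rmap \<Rightarrow> 'k rmap \<Rightarrow> bool" where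
  "bar_basis M xs V L \<longleftrightarrow> bar_system M xs V L \<and> (\<forall>x. V x * L x = 1\<^sub>m (vdim M x))"

lemma bar_systemD:
  assumes "bar_system M xs V L"
  shows "dim_row (arr M x) = vdim M (Suc x)" "dim_col (arr M x) = vdim M x"
    "dim_row (V x) = vdim M x" "dim_col (V x) = length xs"
    "dim_row (L x) = length xs" "dim_col (L x) = vdim M x"
    "L x * V x = alive_mat xs x" "V x * alive_mat xs x = V x" "alive_mat xs x * L x = L x"
    "arr M x * V x = V (Suc x) * alive_mat xs x" "L (Suc x) * arr M x = alive_mat xs (Suc x) * L x"
  using assms unfolding bar_system_def by (blast dest: carrier_matD)+

lemma equi_simps [simp]: "asrc equi i = i" "atgt equi i = Suc i"
  by (simp_all add: asrc_def atgt_def equi_def)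

lemma rep_hom_equiD:
  assumes "f \<in> rep_hom equi M N"
  shows "dim_row (f x) = vdim N x" "dim_col (f x) = vdim M x" "f (Suc x) * arr M x = arr N x * f x"
proof -
  have "f x \<in> carrier_mat (vdim N x) (vdim M x)" using assms by (auto simp: rep_hom_def)
  then show "dim_row (f x) = vdim N x" "dim_col (f x) = vdim M x" by auto
  have "f (atgt equi x) * arr M x = arr N x * f (asrc equi x)" using assms unfolding rep_hom_def by blast
  then show "f (Suc x) * arr M x = arr N x * f x" by simp
qed

lemma rep_hom_equiI:
  assumes "\<And>x. f x \<in> carrier_mat (vdim N x) (vdim M x)" "\<And>x. f (Suc x) * arr M x = arr N x * f x"
  shows "f \<in> rep_hom equi M N"
  using assms by (simp add: rep_hom_def)

lemma is_rep_equiD: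
  assumes "is_rep n equi M"
  shows "dim_row (arr M x) = vdim M (Suc x)" "dim_col (arr M x) = vdim M x"
    "x < 1 \<or> n < x \<Longrightarrow> vdim M x = 0"
proof -
  have "arr M x \<in> carrier_mat (vdim M (atgt equi x)) (vdim M (asrc equi x))"
    using assms unfolding is_rep_def by blast
  then show "dim_row (arr M x) = vdim M (Suc x)" "dim_col (arr M x) = vdim M x" by auto
qed (use assms in \<open>auto simp: is_rep_def\<close>)

lemma bar_basis_transport:
  assumes iso: "rep_iso equi M N f" and N: "bar_basis N xs V L"
    and M: "\<And>x. arr M x \<in> carrier_mat (vdim M (Suc x)) (vdim M x)"
  shows "\<exists>V L. bar_basis M xs V L"
proof -
  obtain g where f: "f \<in> rep_hom equi M N" and g: "g \<in> rep_hom equi N M"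
    and gf: "rep_comp g f = rep_id M" and fg: "rep_comp f g = rep_id N"
    using iso by (auto simp: rep_iso_def)
  have gf': "g x * f x = 1\<^sub>m (vdim M x)" and fg': "f x * g x = 1\<^sub>m (vdim N x)" for x
    using fun_cong[OF gf, of x] fun_cong[OF fg, of x] by (simp_all add: rep_comp_def rep_id_def)
  have VL: "V x * L x = 1\<^sub>m (vdim N x)" for x using N by (simp add: bar_basis_def)
  have N': "bar_system N xs V L" using N by (simp add: bar_basis_def)
  note s = bar_systemD[OF N']
  note d = s(1-6) rep_hom_equiD(1,2)[OF f] rep_hom_equiD(1,2)[OF g] carrier_matD[OF M]
  have "bar_basis M xs (\<lambda>x. g x * V x) (\<lambda>x. L x * f x)"
    unfolding bar_basis_def bar_system_def
  proof (intro conjI allI)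
    fix x
    show "L x * f x * (g x * V x) = alive_mat xs x"
    proof -
      have "L x * f x * (g x * V x) = L x * ((f x * g x) * V x)" by (simp add: mult_mat_assoc d)
      then show ?thesis by (simp add: fg' mult_one_mat d s(7))
    qed
    show "g x * V x * alive_mat xs x = g x * V x" by (simp add: mult_mat_assoc d s(8))
    show "alive_mat xs x * (L x * f x) = L x * f x" by (simp add: d s(9) flip: mult_mat_assoc)
    show "arr M x * (g x * V x) = g (Suc x) * V (Suc x) * alive_mat xs x"
    proof -
      have "arr M x * (g x * V x) = (arr M x * g x) * V x" by (simp add: mult_mat_assoc d)
      also have "\<dots> = g (Suc x) * (arr N x * V x)"
        unfolding rep_hom_equiD(3)[OF g, symmetric] by (simp add: mult_mat_assoc d)
      finally show ?thesis by (simp add: s(10) mult_mat_assoc d)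
    qed
    show "L (Suc x) * f (Suc x) * arr M x = alive_mat xs (Suc x) * (L x * f x)"
    proof -
      have "L (Suc x) * f (Suc x) * arr M x = L (Suc x) * (f (Suc x) * arr M x)" by (simp add: mult_mat_assoc d)
      also have "\<dots> = (L (Suc x) * arr N x) * f x"
        unfolding rep_hom_equiD(3)[OF f] by (simp add: mult_mat_assoc d)
      finally show ?thesis by (simp add: s(11) mult_mat_assoc d)
    qed
    show "g x * V x * (L x * f x) = 1\<^sub>m (vdim M x)"
    proof -
      have "g x * V x * (L x * f x) = g x * ((V x * L x) * f x)" by (simp add: mult_mat_assoc d)
      then show ?thesis by (simp add: VL mult_one_mat d gf')
    qed
  qed (use M in \<open>auto simp: d\<close>)
  then show ?thesis by blast
qed

text \<open>
  The isomorphism sends each basis vector of \<open>M\<close> to the one of \<open>N\<close> with the same bar.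
\<close>

lemma bar_basis_iso:
  assumes M: "bar_basis M xs V L" and N: "bar_basis N xs V' L'"
  shows "rep_isomorphic equi M N"
proof -
  have hom: "(\<lambda>x. V' x * L x) \<in> rep_hom equi M N"
    if M: "bar_system M xs V L" and N: "bar_system N xs V' L'" for M N :: "'a rep" and V L V' L'
  proof (rule rep_hom_equiI)
    note m = bar_systemD[OF M] and n = bar_systemD[OF N]
    fix x
    show "V' x * L x \<in> carrier_mat (vdim N x) (vdim M x)" by (auto simp: m n)
    have "V' (Suc x) * L (Suc x) * arr M x = V' (Suc x) * (alive_mat xs (Suc x) * L x)"
      by (simp add: mult_mat_assoc m(1-6) n(1-6) m(11))
    also have "\<dots> = V' (Suc x) * alive_mat xs (Suc x) * L x"
      by (simp add: mult_mat_assoc m(1-6) n(1-6))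
    also have "\<dots> = V' (Suc x) * (alive_mat xs x * L x)"
      by (simp add: m(9) n(8))
    also have "\<dots> = arr N x * V' x * L x"
      unfolding n(10) by (simp add: mult_mat_assoc m(1-6) n(1-6))
    finally show "V' (Suc x) * L (Suc x) * arr M x = arr N x * (V' x * L x)"
      by (simp add: mult_mat_assoc m(1-6) n(1-6))
  qed
  have inv: "V x * L' x * (V' x * L x) = 1\<^sub>m (vdim M x)"
    if M: "bar_basis M xs V L" and N: "bar_basis N xs V' L'" for M N :: "'a rep" and V L V' L' x
  proof -
    have m: "bar_system M xs V L" and n: "bar_system N xs V' L'" using M N by (simp_all add: bar_basis_def)
    note m = bar_systemD[OF m] and n = bar_systemD[OF n]
    have "V x * L' x * (V' x * L x) = V x * ((L' x * V' x) * L x)"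
      by (simp add: mult_mat_assoc m(1-6) n(1-6))
    also have "\<dots> = V x * L x" by (simp add: n(7) m(9))
    finally show ?thesis using M by (simp add: bar_basis_def)
  qed
  have "rep_iso equi M N (\<lambda>x. V' x * L x)"
    unfolding rep_iso_def rep_comp_def rep_id_def
    using hom inv[OF M N] inv[OF N M] M N unfolding bar_basis_def
    by (intro conjI bexI[of _ "\<lambda>x. V x * L' x"]) auto
  then show ?thesis by (auto simp: rep_isomorphic_def)
qed

definition block_diag :: "'k::field mat \<Rightarrow> 'k mat \<Rightarrow> 'k mat" where
  "block_diag A B = four_block_mat A (0\<^sub>m (dim_row A) (dim_col B)) (0\<^sub>m (dim_row B) (dim_col A)) B"

lemma block_diag_dim [simp]:
  "dim_row (block_diag A B) = dim_row A + dim_row B" "dim_col (block_diag A B) = dim_col A + dim_col B"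
  by (simp_all add: block_diag_def)

lemma block_diag_mult:
  assumes "dim_col A = dim_row A'" "dim_col B = dim_row B'"
  shows "block_diag A B * block_diag A' B' = block_diag (A * A') (B * B')"
  unfolding block_diag_def using assms
  by (subst mult_four_block_mat[of _ "dim_row A" "dim_col A" _ "dim_col B" _ "dim_row B" _ _ "dim_col A'" _ "dim_col B'"])
     (auto intro!: arg_cong3[of _ _ _ _ _ _ "\<lambda>a b c. four_block_mat a b c _"])

lemma block_diag_one: "block_diag (1\<^sub>m p) (1\<^sub>m q) = 1\<^sub>m (p + q)"
  by (rule eq_matI) (auto simp: block_diag_def)

lemma alive_mat_Cons: "alive_mat (I # xs) x = block_diag (alive_mat [I] x) (alive_mat xs x)"
  by (rule eq_matI) (auto simp: block_diag_def alive_mat_def nth_Cons' of_bool_def split: if_splits)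

lemma bar_basis_dsum:
  assumes M: "bar_basis M [I] V L" and N: "bar_basis N xs V' L'"
    and dim: "\<And>x. vdim P x = vdim M x + vdim N x" and arr: "\<And>x. arr P x = block_diag (arr M x) (arr N x)"
  shows "bar_basis P (I # xs) (\<lambda>x. block_diag (V x) (V' x)) (\<lambda>x. block_diag (L x) (L' x))"
proof -
  have "bar_system M [I] V L" "bar_system N xs V' L'" using M N by (simp_all add: bar_basis_def)
  note m = bar_systemD[OF this(1)] and n = bar_systemD[OF this(2)]
  have VL: "V x * L x = 1\<^sub>m (vdim M x)" "V' x * L' x = 1\<^sub>m (vdim N x)" for x
    using M N by (simp_all add: bar_basis_def)
  note dims = m(1-6) n(1-6)
  show ?thesis
    unfolding bar_basis_def bar_system_def alive_mat_Cons[of I xs] arr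
  proof (intro allI conjI)
    fix x
    show "block_diag (arr M x) (arr N x) \<in> carrier_mat (vdim P (Suc x)) (vdim P x)"
      "block_diag (V x) (V' x) \<in> carrier_mat (vdim P x) (length (I # xs))"
      "block_diag (L x) (L' x) \<in> carrier_mat (length (I # xs)) (vdim P x)"
      by (auto simp: dims dim)
  qed (simp_all add: block_diag_mult dims m(7-11) n(7-11) VL block_diag_one dim)
qed

lemma bar_basis_interval:
  "bar_basis (interval_rep equi I :: 'k::field rep) [I]
     (\<lambda>x. if alive I x then 1\<^sub>m 1 else 0\<^sub>m 0 1) (\<lambda>x. if alive I x then 1\<^sub>m 1 else 0\<^sub>m 1 0)"
proof -
  have dim: "vdim (interval_rep equi I :: 'k rep) x = of_bool (alive I x)" for x
    by (simp add: interval_rep_def alive_def case_prod_unfold Let_def)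
  have arr: "arr (interval_rep equi I :: 'k rep) x
    = (if alive I x \<and> alive I (Suc x) then 1\<^sub>m 1 else 0\<^sub>m (of_bool (alive I (Suc x))) (of_bool (alive I x)))" for x
    by (auto simp: interval_rep_def alive_def case_prod_unfold Let_def)
  have alive: "alive_mat [I] x = (if alive I x then 1\<^sub>m 1 else 0\<^sub>m 1 1 :: 'k mat)" for x
    by (auto intro!: eq_matI simp: alive_mat_def)
  show ?thesis
    unfolding bar_basis_def bar_system_def dim arr alive
    by (auto intro!: eq_matI simp: scalar_prod_def)
qed

lemma bar_basis_interval_sum:
  "\<exists>V L. bar_basis (rep_dsum (map (interval_rep equi) xs) :: 'k::field rep) xs V L"
proof (induction xs)
  case Nil
  have "bar_basis (rep_dsum (map (interval_rep equi) []) :: 'k::field rep) [] (\<lambda>_. 0\<^sub>m 0 0) (\<lambda>_. 0\<^sub>m 0 0)"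
    unfolding bar_basis_def bar_system_def by (auto simp: rep_dsum_def alive_mat_def intro!: eq_matI)
  then show ?case by blast
next
  case (Cons I xs)
  then obtain V L where "bar_basis (rep_dsum (map (interval_rep equi) xs) :: 'k rep) xs V L" by blast
  from bar_basis_dsum[OF bar_basis_interval[of I] this, of "rep_dsum (map (interval_rep equi) (I # xs))"]
  show ?case by (force simp: rep_dsum_def Let_def block_diag_def)
qed

section \<open>Existence of interval decompositions\<close>

definition hcat :: "'k mat \<Rightarrow> 'k mat \<Rightarrow> 'k mat" where
  "hcat A B = mat (dim_row A) (dim_col A + dim_col B)
     (\<lambda>(i, j). if j < dim_col A then A $$ (i, j) else B $$ (i, j - dim_col A))"

definition vcat :: "'k mat \<Rightarrow> 'k mat \<Rightarrow> 'k mat" where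
  "vcat A B = mat (dim_row A + dim_row B) (dim_col A)
     (\<lambda>(i, j). if i < dim_row A then A $$ (i, j) else B $$ (i - dim_row A, j))"

lemma hcat_dim [simp]: "dim_row (hcat A B) = dim_row A" "dim_col (hcat A B) = dim_col A + dim_col B"
  and vcat_dim [simp]: "dim_row (vcat A B) = dim_row A + dim_row B" "dim_col (vcat A B) = dim_col A"
  by (simp_all add: hcat_def vcat_def)

lemma mult_hcat:
  assumes "dim_col X = dim_row A" "dim_row A = dim_row B"
  shows "X * hcat A B = hcat (X * A) (X * B)"
  by (rule eq_matI) (use assms in \<open>auto simp: scalar_prod_def hcat_def intro!: sum.cong\<close>)

lemma vcat_mult:
  assumes "dim_col A = dim_row X" "dim_col B = dim_row X"
  shows "vcat A B * X = vcat (A * X) (B * X)"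
  by (rule eq_matI) (use assms in \<open>auto simp: scalar_prod_def vcat_def intro!: sum.cong\<close>)

lemma hcat_alive_mat:
  assumes "dim_row A = dim_row B" "dim_col A = 1" "dim_col B = length xs"
  shows "hcat A B * alive_mat (I # xs) x = hcat (A * alive_mat [I] x) (B * alive_mat xs x)"
  by (rule eq_matI) (use assms in \<open>auto simp: mult_alive_mat hcat_def nth_Cons'\<close>)

lemma alive_mat_vcat:
  assumes "dim_col A = dim_col B" "dim_row A = 1" "dim_row B = length xs"
  shows "alive_mat (I # xs) x * vcat A B = vcat (alive_mat [I] x * A) (alive_mat xs x * B)"
  by (rule eq_matI) (use assms in \<open>auto simp: alive_mat_mult vcat_def nth_Cons'\<close>)

lemma bar_system_Cons:
  fixes M :: "'k::field rep"
  assumes 1: "bar_system M [I] v l" and 2: "bar_system M xs V L"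
    and lV: "\<And>x. l x * V x = 0\<^sub>m 1 (length xs)" and Lv: "\<And>x. L x * v x = 0\<^sub>m (length xs) 1"
  shows "bar_system M (I # xs) (\<lambda>x. hcat (v x) (V x)) (\<lambda>x. vcat (l x) (L x))"
proof -
  note s = bar_systemD[OF 1] and t = bar_systemD[OF 2]
  note dims = s(1-6) t(1-6)
  show ?thesis
    unfolding bar_system_def
  proof (intro allI conjI)
    fix x
    have "vcat (l x) (L x) * hcat (v x) (V x)
        = hcat (vcat (l x * v x) (L x * v x)) (vcat (l x * V x) (L x * V x))"
      by (simp add: mult_hcat vcat_mult dims)
    also have "\<dots> = alive_mat (I # xs) x"
      unfolding s(7) t(7) lV Lv
      by (rule eq_matI) (auto simp: hcat_def vcat_def alive_mat_def nth_Cons')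
    finally show "vcat (l x) (L x) * hcat (v x) (V x) = alive_mat (I # xs) x" .
    show "hcat (v x) (V x) * alive_mat (I # xs) x = hcat (v x) (V x)"
      by (subst hcat_alive_mat) (simp_all add: dims s(8) t(8))
    show "alive_mat (I # xs) x * vcat (l x) (L x) = vcat (l x) (L x)"
      by (subst alive_mat_vcat) (simp_all add: dims s(9) t(9))
    show "arr M x * hcat (v x) (V x) = hcat (v (Suc x)) (V (Suc x)) * alive_mat (I # xs) x"
      by (subst hcat_alive_mat) (simp_all add: mult_hcat dims s(10) t(10))
    show "vcat (l (Suc x)) (L (Suc x)) * arr M x = alive_mat (I # xs) (Suc x) * vcat (l x) (L x)"
      by (subst alive_mat_vcat) (simp_all add: vcat_mult dims s(11) t(11))
  qed (auto simp: dims)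
qed

text \<open>
  This bound is what makes a maximal system of bars exist: at each vertex the vectors of the bars
  alive there are linearly independent.
\<close>

lemma bar_system_length:
  assumes M: "is_rep n equi M" and sys: "bar_system M xs V L" and xs: "\<And>I. I \<in> set xs \<Longrightarrow> bar n I"
  shows "length xs \<le> (\<Sum>x\<in>{1..n}. vdim M x)"
proof -
  note s = bar_systemD[OF sys]
  define A where "A x = {j. j < length xs \<and> alive (xs ! j) x}" for x
  have fin: "finite (A x)" for x by (simp add: A_def)
  have "card (A x) \<le> vdim M x" for x
  proof (rule ccontr)
    assume "\<not> ?thesis"
    then have "card {..<vdim M x} < card (A x)" by simp
    then obtain c where c: "\<exists>a\<in>A x. c a \<noteq> 0" "\<forall>b\<in>{..<vdim M x}. (\<Sum>a\<in>A x. V x $$ (b, a) * c a) = 0"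
      using homogeneous_system_nontrivial_solution[of "{..<vdim M x}" "A x" "\<lambda>b a. V x $$ (b, a)"] fin by blast
    then obtain i where i: "i \<in> A x" "c i \<noteq> 0" by blast
    have "0 = (\<Sum>b<vdim M x. L x $$ (i, b) * (\<Sum>a\<in>A x. V x $$ (b, a) * c a))" using c(2) by simp
    also have "\<dots> = (\<Sum>a\<in>A x. (\<Sum>b<vdim M x. L x $$ (i, b) * V x $$ (b, a)) * c a)"
      unfolding sum_distrib_left sum_distrib_right by (subst sum.swap) (simp add: mult.assoc)
    also have "\<dots> = (\<Sum>a\<in>A x. of_bool (i = a) * c a)"
    proof (rule sum.cong[OF refl])
      fix a assume a: "a \<in> A x"
      have "(L x * V x) $$ (i, a) = (\<Sum>b<vdim M x. L x $$ (i, b) * V x $$ (b, a))"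
        using i a by (simp add: A_def s(1-6) scalar_prod_def lessThan_atLeast0)
      moreover have "alive_mat xs x $$ (i, a) = (of_bool (i = a) :: 'a)"
        using i a by (auto simp: A_def alive_mat_def)
      ultimately show "(\<Sum>b<vdim M x. L x $$ (i, b) * V x $$ (b, a)) * c a = of_bool (i = a) * c a"
        by (simp add: s(7))
    qed
    also have "\<dots> = c i" using i fin by simp
    finally show False using i by simp
  qed
  moreover have "{..<length xs} \<subseteq> (\<Union>x\<in>{1..n}. A x)"
  proof
    fix j assume j: "j \<in> {..<length xs}"
    then have "bar n (xs ! j)" using xs by simp
    then show "j \<in> (\<Union>x\<in>{1..n}. A x)"
      using j by (auto simp: A_def bar_def alive_def intro!: bexI[of _ "fst (xs ! j)"])
  qed
  then have "length xs \<le> card (\<Union>x\<in>{1..n}. A x)"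
    using card_mono[of "\<Union>x\<in>{1..n}. A x" "{..<length xs}"] fin by simp
  moreover have "card (\<Union>x\<in>{1..n}. A x) \<le> (\<Sum>x\<in>{1..n}. card (A x))" by (rule card_UN_le) simp
  ultimately show ?thesis by (meson sum_mono order_trans)
qed

lemma mat_minus_eq_0:
  assumes "dim_row A = dim_row B" "dim_col A = dim_col B" "A - B = 0\<^sub>m (dim_row B) (dim_col B)"
  shows "A = (B :: 'k::field mat)"
proof (rule eq_matI)
  fix i j assume "i < dim_row B" "j < dim_col B"
  then show "A $$ (i, j) = B $$ (i, j)"
    using arg_cong[OF assms(3), of "\<lambda>A. A $$ (i, j)"] assms(1,2) by simp
qed (use assms in auto)

text \<open>
  Let \<open>b\<close> be the first vertex with \<open>e b \<noteq> 0\<close> and \<open>w\<close> a nonzero vector of the image of \<open>e b\<close>. The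
  images of \<open>w\<close> along the structure maps are the vectors of a bar \<open>\<langle>b, b + D\<rangle>\<close>. A functional
  on the last nonzero image, made to factor through \<open>e\<close> and pulled back along the structure maps,
  gives the coordinate functional. It is natural also at the edge before \<open>b\<close>, because it factors
  through \<open>e\<close> and \<open>e\<close> vanishes before \<open>b\<close>.
\<close>

lemma natural_idempotent_bar:
  fixes M :: "'k::field rep"
  assumes M: "is_rep n equi M"
    and dim: "\<And>x. e x \<in> carrier_mat (vdim M x) (vdim M x)"
    and idem: "\<And>x. e x * e x = e x"
    and nat: "\<And>x. arr M x * e x = e (Suc x) * arr M x"
    and nz: "e x \<noteq> 0\<^sub>m (vdim M x) (vdim M x)"
  shows "\<exists>I v l. bar n I \<and> bar_system M [I] v l \<and> (\<forall>x. e x * v x = v x \<and> l x * e x = l x)"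
proof -
  define b where "b = (LEAST x. e x \<noteq> 0\<^sub>m (vdim M x) (vdim M x))"
  have eb: "e b \<noteq> 0\<^sub>m (vdim M b) (vdim M b)" unfolding b_def using nz by (rule LeastI)
  have e0: "e x = 0\<^sub>m (vdim M x) (vdim M x)" if "x < b" for x
    using that not_less_Least unfolding b_def by blast
  note d = carrier_matD[OF dim] is_rep_equiD(1,2)[OF M]
  have "\<exists>q p. q < vdim M b \<and> p < vdim M b \<and> e b $$ (q, p) \<noteq> 0"
  proof (rule ccontr)
    assume "\<not> ?thesis"
    then have "e b = 0\<^sub>m (vdim M b) (vdim M b)" by (intro eq_matI) (auto simp: d)
    then show False using eb by simp
  qed
  then obtain q p where qp: "q < vdim M b" "p < vdim M b" "e b $$ (q, p) \<noteq> 0" by blast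
  \<comment> \<open>A nonzero column of \<open>e b\<close>; its images under the structure maps are the vectors of the bar.\<close>
  define w where "w = e b * mat (vdim M b) 1 (\<lambda>(i, j). of_bool (i = p))"
  define u where "u k = structure_map M b k * w" for k
  have w0: "w $$ (q, 0) = e b $$ (q, p)"
    using qp by (simp add: w_def d scalar_prod_def)
  have wd: "dim_row w = vdim M b" "dim_col w = 1" by (simp_all add: w_def d)
  have sd: "dim_row (structure_map M b k) = vdim M (b + k)" "dim_col (structure_map M b k) = vdim M b" for k
    by (induction k) (simp_all add: d)
  have ud: "dim_row (u k) = vdim M (b + k)" "dim_col (u k) = 1" for k by (simp_all add: u_def sd wd)
  have u0: "u 0 = w" by (simp add: u_def mult_one_mat wd)
  have uS: "u (Suc k) = arr M (b + k) * u k" for k by (simp add: u_def mult_mat_assoc sd wd d)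
  have eu: "e (b + k) * u k = u k" for k
  proof (induction k)
    case 0
    have "e b * w = w" unfolding w_def by (simp add: d idem flip: mult_mat_assoc)
    then show ?case by (simp add: u0)
  next
    case (Suc k)
    have "e (b + Suc k) * u (Suc k) = (e (Suc (b + k)) * arr M (b + k)) * u k"
      by (simp add: uS mult_mat_assoc d ud)
    also have "\<dots> = arr M (b + k) * (e (b + k) * u k)" by (simp add: nat[symmetric] mult_mat_assoc d ud)
    finally show ?case by (simp add: Suc uS)
  qed
  have zero: "u k = 0\<^sub>m (vdim M (b + k)) 1" if "vdim M (b + k) = 0" for k
    using that by (intro eq_matI) (auto simp: ud)
  have ex: "\<exists>k. u k = 0\<^sub>m (vdim M (b + k)) 1"
    using zero[of "Suc n"] is_rep_equiD(3)[OF M, of "b + Suc n"] by (intro exI[of _ "Suc n"]) simp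
  define K where "K = (LEAST k. u k = 0\<^sub>m (vdim M (b + k)) 1)"
  have uK: "u K = 0\<^sub>m (vdim M (b + K)) 1" unfolding K_def using ex by (rule LeastI_ex)
  have "K \<noteq> 0"
  proof
    assume "K = 0"
    then have "w $$ (q, 0) = 0" using uK u0 qp by simp
    then show False using w0 qp by simp
  qed
  then obtain D where D: "K = Suc D" by (cases K) auto
  have uD: "u D \<noteq> 0\<^sub>m (vdim M (b + D)) 1"
    using not_less_Least[of D "\<lambda>k. u k = 0\<^sub>m (vdim M (b + k)) 1"] D K_def by simp
  have "\<exists>r. r < vdim M (b + D) \<and> u D $$ (r, 0) \<noteq> 0"
  proof (rule ccontr)
    assume "\<not> ?thesis"
    then have "u D = 0\<^sub>m (vdim M (b + D)) 1" by (intro eq_matI) (auto simp: ud)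
    then show False using uD by simp
  qed
  then obtain r where r: "r < vdim M (b + D)" "u D $$ (r, 0) \<noteq> 0" by blast
  define Q where "Q = mat 1 (vdim M (b + D)) (\<lambda>(i, j). if j = r then inverse (u D $$ (r, 0)) else 0)"
  have Qd: "dim_row Q = 1" "dim_col Q = vdim M (b + D)" by (simp_all add: Q_def)
  have Qu: "Q * u D = 1\<^sub>m 1"
    using r by (intro eq_matI) (auto simp: Q_def ud scalar_prod_def if_distrib[of "\<lambda>a. a * _"] cong: if_cong)
  \<comment> \<open>The functionals are built backwards from the death of the bar; \<open>T m\<close> lives at \<open>b + D - m\<close>.\<close>
  define T where "T = rec_nat (Q * e (b + D)) (\<lambda>m A. A * arr M (b + (D - Suc m)))"
  define \<mu> where "\<mu> k = T (D - k)" for k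
  have \<mu>D: "\<mu> D = Q * e (b + D)" by (simp add: \<mu>_def T_def)
  have \<mu>S: "\<mu> (Suc k) * arr M (b + k) = \<mu> k" if "k < D" for k
  proof -
    have "D - k = Suc (D - Suc k)" "D - Suc (D - Suc k) = k" using that by auto
    then show ?thesis by (simp add: \<mu>_def T_def)
  qed
  have \<mu>: "dim_row (\<mu> k) = 1 \<and> dim_col (\<mu> k) = vdim M (b + k) \<and> \<mu> k * e (b + k) = \<mu> k \<and> \<mu> k * u k = 1\<^sub>m 1"
    if "k \<le> D" for k
    using that
  proof (induction k rule: inc_induct)
    case base
    show ?case by (simp add: \<mu>D Qd d mult_mat_assoc idem eu ud Qu)
  next
    case (step k)
    have dk: "dim_row (\<mu> (Suc k)) = 1" "dim_col (\<mu> (Suc k)) = vdim M (Suc (b + k))" using step.IH by auto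
    have "\<mu> k * e (b + k) = \<mu> (Suc k) * (arr M (b + k) * e (b + k))"
      by (simp add: \<mu>S[OF step(2), symmetric] mult_mat_assoc d dk)
    also have "\<dots> = (\<mu> (Suc k) * e (b + Suc k)) * arr M (b + k)" by (simp add: nat mult_mat_assoc d dk)
    also have "\<dots> = \<mu> k" using step.IH \<mu>S[OF step(2)] by simp
    finally have 1: "\<mu> k * e (b + k) = \<mu> k" .
    have "\<mu> k * u k = \<mu> (Suc k) * u (Suc k)"
      by (simp add: \<mu>S[OF step(2), symmetric] uS mult_mat_assoc d dk ud)
    then show ?case using 1 step.IH \<mu>S[OF step(2), symmetric] d by simp
  qed
  define I where "I = (b, b + D)"
  define v where "v x = (if alive I x then u (x - b) else 0\<^sub>m (vdim M x) 1)" for x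
  define l where "l x = (if alive I x then \<mu> (x - b) else 0\<^sub>m 1 (vdim M x))" for x
  have al: "alive I x \<longleftrightarrow> (\<exists>k\<le>D. x = b + k)" for x
    by (auto simp: alive_def I_def intro!: exI[of _ "x - b"])
  have alive: "alive_mat [I] x = (if alive I x then 1\<^sub>m 1 else 0\<^sub>m 1 1 :: 'k mat)" for x
    by (auto intro!: eq_matI simp: alive_mat_def)
  have vd: "dim_row (v x) = vdim M x" "dim_col (v x) = 1" for x by (auto simp: v_def ud al)
  have ld: "dim_row (l x) = 1" "dim_col (l x) = vdim M x" for x using \<mu> by (auto simp: l_def al)
  have ev: "e x * v x = v x" and le: "l x * e x = l x" for x
    using eu \<mu> by (auto simp: v_def l_def al d)
  have "bar n I"
  proof -
    have "vdim M b \<noteq> 0" "vdim M (b + D) \<noteq> 0" using qp r by auto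
    then show ?thesis
      using is_rep_equiD(3)[OF M, of b] is_rep_equiD(3)[OF M, of "b + D"] by (force simp: bar_def I_def)
  qed
  moreover have "bar_system M [I] v l"
    unfolding bar_system_def
  proof (intro allI conjI)
    fix x
    show "arr M x \<in> carrier_mat (vdim M (Suc x)) (vdim M x)" "v x \<in> carrier_mat (vdim M x) (length [I])"
      "l x \<in> carrier_mat (length [I]) (vdim M x)" by (auto simp: d vd ld)
    show "l x * v x = alive_mat [I] x" using \<mu> by (auto simp: alive l_def v_def al)
    show "v x * alive_mat [I] x = v x" "alive_mat [I] x * l x = l x"
      by (auto simp: alive mult_mat_one mult_one_mat vd ld) (auto simp: v_def l_def)
    show "arr M x * v x = v (Suc x) * alive_mat [I] x"
    proof (cases "alive I x")
      case True
      then obtain k where k: "k \<le> D" "x = b + k" by (auto simp: al)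
      have "v (Suc x) = u (Suc k)"
        using uK k by (cases "k = D") (auto simp: v_def alive_def I_def D Suc_diff_le)
      then show ?thesis using True k by (simp add: alive v_def[of "b + k"] uS mult_mat_one ud)
    qed (simp add: alive v_def[of x] d vd)
    show "l (Suc x) * arr M x = alive_mat [I] (Suc x) * l x"
    proof (cases "alive I (Suc x)")
      case True
      then obtain k where k: "k \<le> D" "Suc x = b + k" by (auto simp: al)
      show ?thesis
      proof (cases k)
        case 0
        then have "x < b" using k by simp
        then have "e x = 0\<^sub>m (vdim M x) (vdim M x)" "\<not> alive I x" by (simp_all add: e0 alive_def I_def)
        have "l (Suc x) * arr M x = (l (Suc x) * e (Suc x)) * arr M x" by (simp add: le)
        also have "\<dots> = l (Suc x) * (arr M x * e x)" by (simp add: nat mult_mat_assoc d ld)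
        finally have "l (Suc x) * arr M x = 0\<^sub>m 1 (vdim M x)"
          unfolding \<open>e x = _\<close> by (simp add: d ld)
        then show ?thesis using \<open>\<not> alive I x\<close> True by (simp add: alive l_def)
      next
        case (Suc k')
        then have x: "x = b + k'" "k' < D" using k by auto
        then have "alive I x" by (simp add: alive_def I_def)
        then show ?thesis
          using True \<mu>S[OF x(2)] \<mu>[of k'] x by (simp add: alive l_def mult_one_mat Suc_diff_le)
      qed
    qed (simp add: alive l_def[of "Suc x"] d ld)
  qed
  ultimately show ?thesis using ev le by blast
qed

text \<open>
  In a system with the largest number of bars, the complementary projection \<open>e = 1 - V L\<close> is a
  natural idempotent; if it were nonzero, a bar of its image could be added.
\<close>

lemma bar_basis_exists:
  fixes M :: "'k::field rep"
  assumes M: "is_rep n equi M"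
  shows "\<exists>xs V L. (\<forall>I\<in>set xs. bar n I) \<and> bar_basis M xs V L"
proof -
  define P where "P N \<longleftrightarrow> (\<exists>xs V L. length xs = N \<and> (\<forall>I\<in>set xs. bar n I) \<and> bar_system M xs V L)" for N
  have bound: "N \<le> (\<Sum>x\<in>{1..n}. vdim M x)" if "P N" for N
    using that bar_system_length[OF M] unfolding P_def by blast
  have "bar_system M [] (\<lambda>x. 0\<^sub>m (vdim M x) 0) (\<lambda>x. 0\<^sub>m 0 (vdim M x))"
    unfolding bar_system_def
    by (auto simp: alive_mat_def is_rep_equiD(1,2)[OF M] intro!: eq_matI carrier_matI)
  then have "P 0" unfolding P_def by fastforce
  then obtain N where N: "P N" "\<And>N'. P N' \<Longrightarrow> N' \<le> N"
    using Greatest_le_nat[of P] GreatestI_nat[of P] bound by metis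
  then obtain xs V L where xs: "length xs = N" "\<forall>I\<in>set xs. bar n I" and sys: "bar_system M xs V L"
    unfolding P_def by blast
  note s = bar_systemD[OF sys]
  define e where "e x = 1\<^sub>m (vdim M x) - V x * L x" for x
  have ed: "dim_row (e x) = vdim M x" "dim_col (e x) = vdim M x" for x by (simp_all add: e_def s(1-6))
  have eV: "e x * V x = 0\<^sub>m (vdim M x) (length xs)" for x
  proof -
    have "e x * V x = 1\<^sub>m (vdim M x) * V x - V x * L x * V x"
      unfolding e_def by (rule minus_mult_distrib_mat) (auto simp: s(1-6))
    also have "\<dots> = V x - V x * (L x * V x)" by (simp add: mult_mat_assoc mult_one_mat s(1-6))
    finally show ?thesis by (simp add: s(7) s(8)) (auto intro!: eq_matI simp: s(1-6))
  qed
  have Le: "L x * e x = 0\<^sub>m (length xs) (vdim M x)" for x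
  proof -
    have "L x * e x = L x * 1\<^sub>m (vdim M x) - L x * (V x * L x)"
      unfolding e_def by (rule mult_minus_distrib_mat) (auto simp: s(1-6))
    also have "\<dots> = L x - (L x * V x) * L x" by (simp add: mult_mat_assoc mult_mat_one s(1-6))
    finally show ?thesis by (simp add: s(7) s(9)) (auto intro!: eq_matI simp: s(1-6))
  qed
  have "e x = 0\<^sub>m (vdim M x) (vdim M x)" for x
  proof (rule ccontr)
    assume nz: "e x \<noteq> 0\<^sub>m (vdim M x) (vdim M x)"
    have idem: "e x * e x = e x" for x
    proof -
      have "e x * e x = 1\<^sub>m (vdim M x) * e x - V x * L x * e x"
        unfolding e_def[of x] by (rule minus_mult_distrib_mat) (auto simp: s(1-6))
      also have "V x * L x * e x = 0\<^sub>m (vdim M x) (vdim M x)" by (simp add: mult_mat_assoc ed s(1-6) Le)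
      finally show ?thesis by (simp add: mult_one_mat ed) (auto intro!: eq_matI simp: ed)
    qed
    have nat: "arr M x * e x = e (Suc x) * arr M x" for x
    proof -
      have "V (Suc x) * L (Suc x) * arr M x = V (Suc x) * (alive_mat xs (Suc x) * L x)"
        by (simp add: mult_mat_assoc s(1-6) s(11))
      also have "\<dots> = V (Suc x) * alive_mat xs (Suc x) * L x" by (simp add: mult_mat_assoc s(1-6))
      also have "\<dots> = V (Suc x) * (alive_mat xs x * L x)" by (simp add: s(8) s(9))
      also have "\<dots> = arr M x * V x * L x" by (simp add: s(10) mult_mat_assoc s(1-6))
      finally have "V (Suc x) * L (Suc x) * arr M x = arr M x * (V x * L x)" by (simp add: mult_mat_assoc s(1-6))
      moreover have "e (Suc x) * arr M x = 1\<^sub>m (vdim M (Suc x)) * arr M x - V (Suc x) * L (Suc x) * arr M x"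
        unfolding e_def by (rule minus_mult_distrib_mat) (auto simp: s(1-6))
      moreover have "arr M x * e x = arr M x * 1\<^sub>m (vdim M x) - arr M x * (V x * L x)"
        unfolding e_def by (rule mult_minus_distrib_mat) (auto simp: s(1-6))
      ultimately show ?thesis by (simp add: mult_one_mat mult_mat_one s(1-6))
    qed
    obtain I v l where I: "bar n I" and one: "bar_system M [I] v l"
      and ev: "\<And>x. e x * v x = v x" and le: "\<And>x. l x * e x = l x"
      using natural_idempotent_bar[OF M _ idem nat nz] ed by (metis carrier_matI)
    note t = bar_systemD[OF one]
    have "l x * V x = 0\<^sub>m 1 (length xs)" for x
    proof -
      have "l x * V x = l x * (e x * V x)" by (simp add: le t(1-6) s(1-6) ed flip: mult_mat_assoc)
      then show ?thesis by (simp add: eV t(1-6))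
    qed
    moreover have "L x * v x = 0\<^sub>m (length xs) 1" for x
    proof -
      have "L x * v x = (L x * e x) * v x" by (simp add: ev mult_mat_assoc t(1-6) s(1-6) ed)
      then show ?thesis by (simp add: Le t(1-6))
    qed
    ultimately have "P (Suc N)"
      using bar_system_Cons[OF one sys] xs I unfolding P_def
      by (intro exI[of _ "I # xs"]) auto
    then show False using N(2) by fastforce
  qed
  then have "V x * L x = 1\<^sub>m (vdim M x)" for x
    using mat_minus_eq_0[of "1\<^sub>m (vdim M x)" "V x * L x"] by (simp add: e_def s(1-6))
  then show ?thesis using sys xs unfolding bar_basis_def by blast
qed

section \<open>Algebraic stability\<close>

lemma structure_map_dim:
  assumes "is_rep n equi M"
  shows "dim_row (structure_map M x k) = vdim M (x + k)" "dim_col (structure_map M x k) = vdim M x"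
  by (induction k) (simp_all add: is_rep_equiD[OF assms])

text \<open>
  Intervals are convex: a bar alive at both ends of the path is alive in between.
\<close>

lemma structure_map_bar:
  assumes M: "is_rep n equi M" and sys: "bar_system M xs V L"
  shows "structure_map M x k * V x = V (x + k) * alive_mat xs x"
proof (induction k)
  case 0
  note s = bar_systemD[OF sys]
  show ?case by (simp add: s(8) s(1-6) mult_one_mat)
next
  case (Suc k)
  note s = bar_systemD[OF sys]
  have "structure_map M x (Suc k) * V x = arr M (x + k) * (structure_map M x k * V x)"
    by (simp add: mult_mat_assoc structure_map_dim[OF M] s(1-6))
  also have "\<dots> = arr M (x + k) * V (x + k) * alive_mat xs x"
    unfolding Suc.IH by (simp add: mult_mat_assoc s(1-6))
  also have "\<dots> = V (x + Suc k) * alive_mat xs (x + Suc k) * alive_mat xs (x + k) * alive_mat xs x"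
    unfolding s(10) by (simp add: s(8))
  also have "\<dots> = V (x + Suc k) * alive_mat xs (x + Suc k) * alive_mat xs x"
    by (rule eq_matI) (auto simp: mult_alive_mat s(1-6) alive_def)
  finally show ?case by (simp add: s(8))
qed

text \<open>
  At vertices \<open>x \<ge> 1\<close> the truncation in the definition of the shift is invisible, because \<open>N\<close>
  vanishes beyond \<open>n\<close>.
\<close>

lemma rep_hom_shiftD:
  assumes N: "is_rep n equi N" and f: "f \<in> rep_hom equi M (rep_shift n \<delta> N)" and x: "1 \<le> x"
  shows "dim_row (f x) = vdim N (x + \<delta>)" "dim_col (f x) = vdim M x"
    "f (Suc x) * arr M x = arr N (x + \<delta>) * f x"
proof -
  have dim: "vdim (rep_shift n \<delta> N) y = vdim N (y + \<delta>)" if "1 \<le> y" for y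
    using that is_rep_equiD(3)[OF N, of "y + \<delta>"] by (auto simp: rep_shift_def Let_def)
  have "arr (rep_shift n \<delta> N) x = arr N (x + \<delta>)"
  proof (cases "x + 1 + \<delta> \<le> n")
    case True
    then show ?thesis using x by (simp add: rep_shift_def Let_def)
  next
    case False
    then have "dim_row (arr (rep_shift n \<delta> N) x) = 0" "dim_col (arr (rep_shift n \<delta> N) x) = vdim N (x + \<delta>)"
      using x is_rep_equiD(3)[OF N, of "x + \<delta>"] by (auto simp: rep_shift_def Let_def)
    then show ?thesis
      using False is_rep_equiD[OF N] by (intro eq_matI) simp_all
  qed
  then show "dim_row (f x) = vdim N (x + \<delta>)" "dim_col (f x) = vdim M x"
    "f (Suc x) * arr M x = arr N (x + \<delta>) * f x"
    using rep_hom_equiD[OF f, of x] dim[OF x] by simp_all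
qed

lemma bar_map_of_rep_hom:
  assumes N: "is_rep n equi N" and f: "f \<in> rep_hom equi M (rep_shift n \<delta> N)"
    and BM: "bar_basis M xs V L" and BN: "bar_basis N ys V' L'"
  shows "bar_map \<delta> xs ys (\<lambda>x k j. (L' (x + \<delta>) * f x * V x) $$ (k, j))"
  unfolding bar_map_def
proof (intro allI impI conjI)
  have "bar_system M xs V L" "bar_system N ys V' L'" using BM BN by (simp_all add: bar_basis_def)
  note m = bar_systemD[OF this(1)] and n = bar_systemD[OF this(2)]
  fix x j k :: nat assume x: "1 \<le> x" and j: "j < length xs" and k: "k < length ys"
  note h = rep_hom_shiftD[OF N f x] rep_hom_shiftD[OF N f, of "Suc x"]
  note dims = m(1-6) n(1-6) h(1,2,4,5)
  have "L' (x + \<delta>) * f x * V x = alive_mat ys (x + \<delta>) * (L' (x + \<delta>) * f x * V x * alive_mat xs x)"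
    by (simp add: mult_mat_assoc dims m(8)) (simp add: n(9) dims flip: mult_mat_assoc)
  from arg_cong[OF this, of "\<lambda>A. A $$ (k, j)"]
  have "(L' (x + \<delta>) * f x * V x) $$ (k, j)
      = of_bool (alive (ys ! k) (x + \<delta>)) * ((L' (x + \<delta>) * f x * V x) $$ (k, j) * of_bool (alive (xs ! j) x))"
    using j k by (subst (asm) mult_alive_mat, simp add: dims, subst (asm) alive_mat_mult) (simp_all add: dims)
  then show "alive (xs ! j) x" "alive (ys ! k) (x + \<delta>)" if "(L' (x + \<delta>) * f x * V x) $$ (k, j) \<noteq> 0"
    using that by (cases "alive (xs ! j) x"; cases "alive (ys ! k) (x + \<delta>)"; simp)+
  have "L' (Suc x + \<delta>) * f (Suc x) * V (Suc x) * alive_mat xs x = L' (Suc x + \<delta>) * (f (Suc x) * arr M x) * V x"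
    by (simp add: mult_mat_assoc dims x flip: m(10))
  also have "\<dots> = (L' (Suc (x + \<delta>)) * arr N (x + \<delta>)) * f x * V x"
    using x by (simp add: mult_mat_assoc dims h(3))
  also have "\<dots> = alive_mat ys (Suc x + \<delta>) * (L' (x + \<delta>) * f x * V x)"
    by (simp add: n(11) mult_mat_assoc dims)
  finally have *: "L' (Suc x + \<delta>) * f (Suc x) * V (Suc x) * alive_mat xs x
      = alive_mat ys (Suc x + \<delta>) * (L' (x + \<delta>) * f x * V x)" .
  have "(L' (Suc x + \<delta>) * f (Suc x) * V (Suc x)) $$ (k, j) * of_bool (alive (xs ! j) x)
      = (L' (Suc x + \<delta>) * f (Suc x) * V (Suc x) * alive_mat xs x) $$ (k, j)"
    using j k by (simp add: mult_alive_mat dims)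
  also have "\<dots> = of_bool (alive (ys ! k) (Suc x + \<delta>)) * (L' (x + \<delta>) * f x * V x) $$ (k, j)"
    unfolding * using j k by (simp add: alive_mat_mult dims)
  finally show "of_bool (alive (xs ! j) x) * (L' (x + 1 + \<delta>) * f (x + 1) * V (x + 1)) $$ (k, j)
      = of_bool (alive (ys ! k) (x + 1 + \<delta>)) * (L' (x + \<delta>) * f x * V x) $$ (k, j)"
    by (simp add: mult.commute)
qed

lemma composite_is_shift_of_interleaving:
  assumes M: "is_rep n equi M" and N: "is_rep n equi N"
    and f: "f \<in> rep_hom equi M (rep_shift n \<delta> N)" and g: "g \<in> rep_hom equi N (rep_shift n \<delta> M)"
    and gf: "rep_comp (rmap_shift n \<delta> g) f = shift_unit n (2 * \<delta>) M"
    and BM: "bar_basis M xs V L" and BN: "bar_basis N ys V' L'"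
  shows "composite_is_shift \<delta> xs ys (\<lambda>x k j. (L' (x + \<delta>) * f x * V x) $$ (k, j))
    (\<lambda>x j k. (L (x + \<delta>) * g x * V' x) $$ (j, k))"
  unfolding composite_is_shift_def
proof (intro allI impI)
  have sys: "bar_system M xs V L" "bar_system N ys V' L'" using BM BN by (simp_all add: bar_basis_def)
  note m = bar_systemD[OF this(1)] and n = bar_systemD[OF this(2)]
  have VL: "V' x * L' x = 1\<^sub>m (vdim N x)" for x using BN by (simp add: bar_basis_def)
  fix x i j :: nat assume x: "1 \<le> x" and i: "i < length xs" and j: "j < length xs"
  have x\<delta>: "1 \<le> x + \<delta>" using x by simp
  note h = rep_hom_shiftD[OF N f x] rep_hom_shiftD[OF M g x\<delta>]
  note dims = m(1-6) n(1-6) h(1,2,4,5) structure_map_dim[OF M]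
  have comp: "g (x + \<delta>) * f x = structure_map M x (2 * \<delta>)"
  proof (cases "x + 2 * \<delta> \<le> n")
    case True
    then show ?thesis
      using fun_cong[OF gf, of x] x by (simp add: rep_comp_def rmap_shift_def shift_unit_def)
  next
    case False
    then have "vdim M (x + 2 * \<delta>) = 0" by (simp add: is_rep_equiD(3)[OF M])
    then show ?thesis by (intro eq_matI) (simp_all add: dims mult_2 add.assoc)
  qed
  have "(\<Sum>k<length ys. (L (x + \<delta> + \<delta>) * g (x + \<delta>) * V' (x + \<delta>)) $$ (i, k) * (L' (x + \<delta>) * f x * V x) $$ (k, j))
      = (L (x + \<delta> + \<delta>) * g (x + \<delta>) * V' (x + \<delta>) * (L' (x + \<delta>) * f x * V x)) $$ (i, j)"
    using i j by (simp add: dims scalar_prod_def lessThan_atLeast0)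
  also have "L (x + \<delta> + \<delta>) * g (x + \<delta>) * V' (x + \<delta>) * (L' (x + \<delta>) * f x * V x)
      = L (x + \<delta> + \<delta>) * g (x + \<delta>) * ((V' (x + \<delta>) * L' (x + \<delta>)) * (f x * V x))"
    by (simp add: mult_mat_assoc dims)
  also have "\<dots> = L (x + \<delta> + \<delta>) * ((g (x + \<delta>) * f x) * V x)"
    by (simp add: VL mult_one_mat dims) (simp add: mult_mat_assoc dims)
  also have "\<dots> = L (x + 2 * \<delta>) * V (x + 2 * \<delta>) * alive_mat xs x"
    by (simp add: comp structure_map_bar[OF M sys(1)] mult_mat_assoc dims mult_2 add.assoc)
  also have "\<dots> = alive_mat xs (x + 2 * \<delta>) * alive_mat xs x" by (simp add: m(7))
  also have "\<dots> $$ (i, j) = of_bool (i = j \<and> alive (xs ! j) x \<and> alive (xs ! j) (x + 2 * \<delta>))"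
    using i j by (subst mult_alive_mat) (auto simp: alive_mat_def)
  finally show "(\<Sum>k<length ys. (L (x + \<delta> + \<delta>) * g (x + \<delta>) * V' (x + \<delta>)) $$ (i, k) * (L' (x + \<delta>) * f x * V x) $$ (k, j))
      = of_bool (i = j \<and> alive (xs ! j) x \<and> alive (xs ! j) (x + 2 * \<delta>))" .
qed

lemma interleaving_imp_matching:
  assumes M: "is_rep n equi M" and N: "is_rep n equi N" and fg: "interleaving_pair n \<delta> M N f g"
    and BM: "bar_basis M xs V L" and BN: "bar_basis N ys V' L'"
    and xs: "\<And>I. I \<in> set xs \<Longrightarrow> bar n I" and ys: "\<And>I. I \<in> set ys \<Longrightarrow> bar n I"
  shows "\<exists>\<sigma>. is_matching \<delta> (mset xs) (mset ys) \<sigma>"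
proof -
  have f: "f \<in> rep_hom equi M (rep_shift n \<delta> N)" and g: "g \<in> rep_hom equi N (rep_shift n \<delta> M)"
    and gf: "rep_comp (rmap_shift n \<delta> g) f = shift_unit n (2 * \<delta>) M"
    and fg: "rep_comp (rmap_shift n \<delta> f) g = shift_unit n (2 * \<delta>) N"
    using fg by (simp_all add: interleaving_pair_def)
  show ?thesis
    by (rule bar_maps_imp_matching[where n = n, OF bar_map_of_rep_hom[OF N f BM BN] bar_map_of_rep_hom[OF M g BN BM]
          composite_is_shift_of_interleaving[OF M N f g gf BM BN]
          composite_is_shift_of_interleaving[OF N M g f fg BN BM]]) (use xs ys in auto)
qed

lemma rep_shift_0:
  assumes "is_rep n equi M"
  shows "rep_shift n 0 M = M"
proof (rule rep.equality)
  show "vdim (rep_shift n 0 M) = vdim M"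
  proof
    fix x
    show "vdim (rep_shift n 0 M) x = vdim M x"
      using is_rep_equiD(3)[OF assms, of x] by (cases "1 \<le> x \<and> x \<le> n") (auto simp: rep_shift_def)
  qed
  show "arr (rep_shift n 0 M) = arr M"
  proof
    fix i
    note M = is_rep_equiD(1,2)[OF assms, of i] is_rep_equiD(3)[OF assms, of i]
      is_rep_equiD(3)[OF assms, of "Suc i"]
    show "arr (rep_shift n 0 M) i = arr M i"
    proof (cases "1 \<le> i \<and> i + 1 \<le> n")
      case True
      then show ?thesis by (simp add: rep_shift_def)
    next
      case False
      then have "i < 1 \<or> n < Suc i" by linarith
      then show ?thesis
        using False M by (intro eq_matI) (auto simp: rep_shift_def)
    qed
  qed
qed simp

lemma identity_interleaving:
  assumes M: "is_rep n equi M"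
  shows "interleaving_pair n 0 M M (rep_id M) (rep_id M)"
proof -
  have "rep_id M \<in> rep_hom equi M M"
    by (rule rep_hom_equiI) (simp_all add: rep_id_def is_rep_equiD(1,2)[OF M] mult_one_mat mult_mat_one)
  moreover have "rep_comp (rmap_shift n 0 (rep_id M)) (rep_id M) = shift_unit n 0 M"
  proof
    fix x
    show "rep_comp (rmap_shift n 0 (rep_id M)) (rep_id M) x = shift_unit n 0 M x"
      using is_rep_equiD(3)[OF M, of x]
      by (cases "1 \<le> x \<and> x \<le> n") (auto simp: rep_comp_def rmap_shift_def rep_id_def shift_unit_def)
  qed
  ultimately show ?thesis by (simp add: interleaving_pair_def rep_shift_0[OF M])
qed

text \<open>
  The identity is an interleaving with \<open>\<delta> = 0\<close>. A matching with \<open>\<delta> = 0\<close> leaves no bar unmatched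
  and matches only equal bars.
\<close>

lemma bar_basis_unique:
  assumes M: "is_rep n equi M" and "bar_basis M xs V L" "bar_basis M ys V' L'"
    and xs: "\<And>I. I \<in> set xs \<Longrightarrow> bar n I" and ys: "\<And>I. I \<in> set ys \<Longrightarrow> bar n I"
  shows "mset xs = mset ys"
proof -
  obtain \<sigma> where \<sigma>: "is_matching 0 (mset xs) (mset ys) \<sigma>"
    using interleaving_imp_matching[OF M M identity_interleaving[OF M] assms(2,3) xs ys] by blast
  have full: "B = C" if "C \<subseteq># B" "\<forall>(b, d)\<in>#B - C. \<not> int d - int b \<ge> 2 * int 0" "\<forall>I\<in>#B. bar n I"
    for B C :: "(nat \<times> nat) multiset"
  proof -
    have "B - C = {#}"
    proof (rule ccontr)
      assume "B - C \<noteq> {#}"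
      then obtain b d where bd: "(b, d) \<in># B - C" by (metis multiset_nonemptyE surj_pair)
      then have "bar n (b, d)" using that(3) in_diffD by fastforce
      then show False using that(2) bd by (auto simp: bar_def)
    qed
    then show ?thesis using that(1) by (metis Diff_eq_empty_iff_mset subset_mset.antisym)
  qed
  have "image_mset fst \<sigma> = image_mset snd \<sigma>"
    using \<sigma> unfolding is_matching_def by (intro image_mset_cong) force
  moreover have "mset xs = image_mset fst \<sigma>" "mset ys = image_mset snd \<sigma>"
    by (rule full; use \<sigma> xs ys in \<open>simp add: is_matching_def\<close>)+
  ultimately show ?thesis by simp
qed

lemma barcode_eq:
  assumes M: "is_rep n equi M" and basis: "bar_basis M xs V L" and xs: "\<And>I. I \<in> set xs \<Longrightarrow> bar n I"
  shows "barcode n equi M = mset xs"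
  unfolding barcode_def
proof (rule the_equality)
  obtain V' L' where "bar_basis (rep_dsum (map (interval_rep equi) xs) :: 'a rep) xs V' L'"
    using bar_basis_interval_sum by blast
  then have "rep_isomorphic equi M (rep_dsum (map (interval_rep equi) xs))"
    by (rule bar_basis_iso[OF basis])
  then show "is_barcode n equi M (mset xs)"
    using xs unfolding is_barcode_def bar_def by fastforce
  fix B assume B: "is_barcode n equi M B"
  then obtain ys f where ys: "mset ys = B"
    and iso: "rep_iso equi M (rep_dsum (map (interval_rep equi) ys)) f"
    unfolding is_barcode_def rep_isomorphic_def by blast
  obtain V' L' where "bar_basis (rep_dsum (map (interval_rep equi) ys) :: 'a rep) ys V' L'"
    using bar_basis_interval_sum by blast
  then obtain V'' L'' where basis': "bar_basis M ys V'' L''"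
    using bar_basis_transport[OF iso] is_rep_equiD(1,2)[OF M] by (metis carrier_matI)
  have "bar n I" if "I \<in> set ys" for I
    using B that unfolding is_barcode_def ys[symmetric] bar_def by fastforce
  then show "B = mset xs" using bar_basis_unique[OF M basis' basis _ xs] ys by simp
qed

lemma algebraic_stability:
  assumes M: "is_rep n equi M" and N: "is_rep n equi N" and fg: "interleaving_pair n \<delta> M N f g"
  shows "\<exists>\<sigma>. is_matching \<delta> (barcode n equi M) (barcode n equi N) \<sigma>"
proof -
  obtain xs V L where xs: "\<And>I. I \<in> set xs \<Longrightarrow> bar n I" "bar_basis M xs V L"
    using bar_basis_exists[OF M] by blast
  obtain ys V' L' where ys: "\<And>I. I \<in> set ys \<Longrightarrow> bar n I" "bar_basis N ys V' L'"
    using bar_basis_exists[OF N] by blast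
  show ?thesis
    using interleaving_imp_matching[OF M N fg xs(2) ys(2) xs(1) ys(1)]
    by (simp add: barcode_eq[OF M xs(2,1)] barcode_eq[OF N ys(2,1)])
qed

section \<open>Cohomology as a representation\<close>

lemma mult_mat_zero_vec: "A \<in> carrier_mat r c \<Longrightarrow> A *\<^sub>v 0\<^sub>v c = (0\<^sub>v r :: 'k::field vec)"
  by (intro eq_vecI) (auto simp: scalar_prod_def)

lemma zero_mat_mult_vec: "v \<in> carrier_vec c \<Longrightarrow> 0\<^sub>m r c *\<^sub>v v = (0\<^sub>v r :: 'k::field vec)"
  by (intro eq_vecI) (auto simp: scalar_prod_def)

lemma vec_minus_eq_0:
  assumes "u \<in> carrier_vec m" "v \<in> carrier_vec m" "u - v = (0\<^sub>v m :: 'k::field vec)"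
  shows "u = v"
proof (rule eq_vecI)
  fix i assume "i < dim_vec v"
  then show "u $ i = v $ i"
    using arg_cong[OF assms(3), of "\<lambda>v. v $ i"] assms(1,2) by simp
qed (use assms in auto)

text \<open>
  A nontrivial solution of \<open>W v = 0\<close> would be killed by the left inverse.
\<close>

lemma left_inverse_dim:
  assumes "W \<in> carrier_mat m h" "R \<in> carrier_mat h m" "R * W = (1\<^sub>m h :: 'k::field mat)"
  shows "h \<le> m"
proof (rule ccontr)
  assume "\<not> h \<le> m"
  then obtain c where c: "\<exists>a\<in>{..<h}. c a \<noteq> 0" "\<forall>b\<in>{..<m}. (\<Sum>a<h. W $$ (b, a) * c a) = 0"
    using homogeneous_system_nontrivial_solution[of "{..<m}" "{..<h}" "\<lambda>b a. W $$ (b, a)"] by auto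
  define v where "v = vec h c"
  have "W *\<^sub>v v = 0\<^sub>v m"
    using c(2) assms(1) by (intro eq_vecI) (auto simp: v_def scalar_prod_def lessThan_atLeast0)
  moreover have "v = R *\<^sub>v (W *\<^sub>v v)"
    using assoc_mult_mat_vec[OF assms(2,1), of v] by (simp add: assms(3) v_def)
  ultimately have "v = 0\<^sub>v h" using mult_mat_zero_vec[OF assms(2)] by simp
  then have "v $ a = 0" if "a < h" for a using that by simp
  then have "c a = 0" if "a < h" for a using that by (simp add: v_def)
  then show False using c(1) by auto
qed

text \<open>
  A basis of \<open>U\<close>, the columns of \<open>W\<close>, with functionals dual to it on the whole space, the rows of
  \<open>R\<close>. It is obtained as a largest system with \<open>R W = 1\<close>: a vector of \<open>U\<close> not fixed by \<open>W R\<close> has a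
  nonzero component in the kernel of \<open>R\<close>, which enlarges the system.
\<close>

lemma subspace_dual_basis:
  fixes U :: "'k::field vec set"
  assumes U: "U \<subseteq> carrier_vec m" "0\<^sub>v m \<in> U"
    and add: "\<And>u v. u \<in> U \<Longrightarrow> v \<in> U \<Longrightarrow> u + v \<in> U"
    and smult: "\<And>c u. u \<in> U \<Longrightarrow> c \<cdot>\<^sub>v u \<in> U"
  obtains h W R where "W \<in> carrier_mat m h" "R \<in> carrier_mat h m" "R * W = 1\<^sub>m h"
    "\<And>c. c \<in> carrier_vec h \<Longrightarrow> W *\<^sub>v c \<in> U" "\<And>u. u \<in> U \<Longrightarrow> W *\<^sub>v (R *\<^sub>v u) = u"
proof -
  define Q where "Q h W R \<longleftrightarrow> W \<in> carrier_mat m h \<and> R \<in> carrier_mat h m \<and> R * W = 1\<^sub>m h \<and>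
      (\<forall>c\<in>carrier_vec h. W *\<^sub>v c \<in> U)" for h and W R :: "'k mat"
  have bound: "h \<le> m" if "\<exists>W R. Q h W R" for h
    using that left_inverse_dim unfolding Q_def by blast
  have "Q 0 (0\<^sub>m m 0) (0\<^sub>m 0 m)"
    unfolding Q_def
  proof (intro conjI ballI)
    fix c :: "'k vec" assume "c \<in> carrier_vec 0"
    then have "0\<^sub>m m 0 *\<^sub>v c = 0\<^sub>v m" by (intro eq_vecI) (auto simp: scalar_prod_def)
    then show "0\<^sub>m m 0 *\<^sub>v c \<in> U" using U(2) by simp
  qed auto
  then have "\<exists>W R. Q 0 W R" by blast
  then have "\<exists>h. (\<exists>W R. Q h W R) \<and> (\<forall>h'. (\<exists>W R. Q h' W R) \<longrightarrow> h' \<le> h)"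
    by (rule ex_has_greatest_nat[of _ _ "\<lambda>h. h" "Suc m"]) (use bound le_imp_less_Suc in blast)
  then obtain h where h: "\<exists>W R. Q h W R" "\<And>h'. \<exists>W R. Q h' W R \<Longrightarrow> h' \<le> h" by blast
  then obtain W R where "Q h W R" by blast
  then have W: "W \<in> carrier_mat m h" and R: "R \<in> carrier_mat h m" and RW: "R * W = 1\<^sub>m h"
    and WU: "\<And>c. c \<in> carrier_vec h \<Longrightarrow> W *\<^sub>v c \<in> U"
    by (auto simp: Q_def)
  have "W *\<^sub>v (R *\<^sub>v u) = u" if u: "u \<in> U" for u
  proof (rule ccontr)
    assume ne: "W *\<^sub>v (R *\<^sub>v u) \<noteq> u"
    have um: "u \<in> carrier_vec m" using u U by blast
    \<comment> \<open>The difference, written as a sum so that the closure properties of \<open>U\<close> apply.\<close>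
    define w where "w = u + (- 1) \<cdot>\<^sub>v (W *\<^sub>v (R *\<^sub>v u))"
    have WRu: "W *\<^sub>v (R *\<^sub>v u) \<in> carrier_vec m" and Ru: "R *\<^sub>v u \<in> carrier_vec h" using W R um by auto
    have wU: "w \<in> U" unfolding w_def using u WU[OF Ru] add smult by blast
    have wm: "w \<in> carrier_vec m" using wU U by blast
    have "w = u - W *\<^sub>v (R *\<^sub>v u)" unfolding w_def using WRu um by auto
    then have "w \<noteq> 0\<^sub>v m" using ne vec_minus_eq_0[OF um WRu] by auto
    moreover have "w = 0\<^sub>v m" if "\<And>q. q < m \<Longrightarrow> w $ q = 0"
      using that wm by (intro eq_vecI) simp_all
    ultimately obtain q where q: "q < m" "w $ q \<noteq> 0" by blast
    have "R *\<^sub>v w = R *\<^sub>v u - R *\<^sub>v (W *\<^sub>v (R *\<^sub>v u))"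
      unfolding \<open>w = u - _\<close> by (rule mult_minus_distrib_mat_vec[OF R um WRu])
    also have "R *\<^sub>v (W *\<^sub>v (R *\<^sub>v u)) = R *\<^sub>v u"
      using assoc_mult_mat_vec[OF R W Ru] RW Ru by simp
    finally have Rw: "R *\<^sub>v w = 0\<^sub>v h" using Ru by auto
    define w' where "w' = mat m 1 (\<lambda>(i, j). w $ i)"
    \<comment> \<open>A functional with value one on \<open>w\<close> that vanishes on the columns of \<open>W\<close>.\<close>
    define l where "l = mat 1 m (\<lambda>(i, j). if j = q then inverse (w $ q) else 0) * (1\<^sub>m m - W * R)"
    have d: "dim_row W = m" "dim_col W = h" "dim_row R = h" "dim_col R = m" "dim_row w' = m" "dim_col w' = 1"
      "dim_row l = 1" "dim_col l = m"
      using W R by (auto simp: w'_def l_def)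
    have Rw': "R * w' = 0\<^sub>m h 1"
    proof (rule eq_matI)
      fix i j assume ij: "i < dim_row (0\<^sub>m h 1 :: 'k mat)" "j < dim_col (0\<^sub>m h 1 :: 'k mat)"
      have "col w' j = w" using ij wm by (auto simp: w'_def)
      then show "(R * w') $$ (i, j) = 0\<^sub>m h 1 $$ (i, j)"
        using ij arg_cong[OF Rw, of "\<lambda>v. v $ i"] d by simp
    qed (simp_all add: d)
    have "(1\<^sub>m m - W * R) * W = 1\<^sub>m m * W - W * R * W"
      by (rule minus_mult_distrib_mat[OF one_carrier_mat mult_carrier_mat[OF W R] W])
    also have "\<dots> = 0\<^sub>m m h" using W by (simp add: mult_mat_assoc d RW mult_mat_one mult_one_mat)
    finally have lW: "l * W = 0\<^sub>m 1 h" unfolding l_def by (simp add: mult_mat_assoc d)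
    have "(1\<^sub>m m - W * R) * w' = 1\<^sub>m m * w' - W * R * w'"
      by (rule minus_mult_distrib_mat[OF one_carrier_mat mult_carrier_mat[OF W R] carrier_matI[OF d(5,6)]])
    also have "\<dots> = w'" by (simp add: mult_mat_assoc d Rw' mult_one_mat) (auto simp: d intro!: eq_matI)
    finally have "l * w' = mat 1 m (\<lambda>(i, j). if j = q then inverse (w $ q) else 0) * w'"
      unfolding l_def by (simp add: mult_mat_assoc d)
    also have "\<dots> = 1\<^sub>m 1"
      using q by (intro eq_matI) (auto simp: w'_def scalar_prod_def if_distrib[of "\<lambda>a. a * _"] cong: if_cong)
    finally have lw: "l * w' = 1\<^sub>m 1" .
    have "Q (Suc h) (hcat w' W) (vcat l R)"
      unfolding Q_def
    proof (intro conjI ballI)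
      show "hcat w' W \<in> carrier_mat m (Suc h)" "vcat l R \<in> carrier_mat (Suc h) m" by (auto simp: d)
      have "vcat l R * hcat w' W = hcat (vcat (l * w') (R * w')) (vcat (l * W) (R * W))"
        by (simp add: mult_hcat vcat_mult d)
      also have "\<dots> = 1\<^sub>m (Suc h)"
        unfolding lw Rw' lW RW by (rule eq_matI) (auto simp: hcat_def vcat_def)
      finally show "vcat l R * hcat w' W = 1\<^sub>m (Suc h)" .
      fix c :: "'k vec" assume c: "c \<in> carrier_vec (Suc h)"
      have "hcat w' W *\<^sub>v c = c $ 0 \<cdot>\<^sub>v w + W *\<^sub>v vec h (\<lambda>i. c $ Suc i)"
      proof (rule eq_vecI)
        fix i assume "i < dim_vec (c $ 0 \<cdot>\<^sub>v w + W *\<^sub>v vec h (\<lambda>i. c $ Suc i))"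
        then have i: "i < m" using d by simp
        have "(hcat w' W *\<^sub>v c) $ i = (\<Sum>j\<in>{0..<Suc h}. hcat w' W $$ (i, j) * c $ j)"
          using i c by (simp add: scalar_prod_def d)
        also have "\<dots> = w $ i * c $ 0 + (\<Sum>j\<in>{0..<h}. W $$ (i, j) * c $ Suc j)"
          using i by (subst sum.atLeast0_lessThan_Suc_shift) (simp add: hcat_def d w'_def)
        finally show "(hcat w' W *\<^sub>v c) $ i = (c $ 0 \<cdot>\<^sub>v w + W *\<^sub>v vec h (\<lambda>i. c $ Suc i)) $ i"
          using i wm by (simp add: scalar_prod_def d mult.commute)
      qed (simp add: d)
      also have "\<dots> \<in> U" by (intro add smult wU WU) simp
      finally show "hcat w' W *\<^sub>v c \<in> U" .
    qed
    then have "Suc h \<le> h" using h(2) by blast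
    then show False by simp
  qed
  then show ?thesis using that W R RW WU by blast
qed

lemma mat_imageI: "v \<in> carrier_vec (dim_col B) \<Longrightarrow> B *\<^sub>v v \<in> mat_image B"
  by (simp add: mat_image_def)

text \<open>
  Let \<open>E\<close> be a projection of the ambient space with kernel \<open>im B\<close>. It induces an injection of
  \<open>ker A / im B\<close>, and the functionals dual to a basis of \<open>E (ker A)\<close>, composed with \<open>E\<close>, are the
  rows of the required matrix.
\<close>

lemma coh_proj_exists:
  fixes A B :: "'k::field mat"
  assumes AB: "dim_row B = dim_col A"
  shows "\<exists>P. is_coh_proj B A P"
proof -
  define m where "m = dim_col A"
  have A: "A \<in> carrier_mat (dim_row A) m" and B: "B \<in> carrier_mat m (dim_col B)" using AB by (auto simp: m_def)
  obtain k W R where W: "W \<in> carrier_mat m k" "R \<in> carrier_mat k m"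
      "\<And>c. c \<in> carrier_vec k \<Longrightarrow> W *\<^sub>v c \<in> mat_image B" "\<And>u. u \<in> mat_image B \<Longrightarrow> W *\<^sub>v (R *\<^sub>v u) = u"
  proof (rule subspace_dual_basis[of "mat_image B" m])
    show "mat_image B \<subseteq> carrier_vec m"
      using mult_mat_vec_carrier[OF B] unfolding mat_image_def by blast
    show "0\<^sub>v m \<in> mat_image B"
      unfolding mat_image_def using mult_mat_zero_vec[OF B]
      by (intro image_eqI[of _ _ "0\<^sub>v (dim_col B)"]) simp_all
    show "u + v \<in> mat_image B" if im: "u \<in> mat_image B" "v \<in> mat_image B" for u v
    proof -
      obtain u' v' where uv: "u = B *\<^sub>v u'" "u' \<in> carrier_vec (dim_col B)"
          "v = B *\<^sub>v v'" "v' \<in> carrier_vec (dim_col B)"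
        using im unfolding mat_image_def by blast
      then have "u + v = B *\<^sub>v (u' + v')" using mult_add_distrib_mat_vec[OF B uv(2,4)] by simp
      then show ?thesis using mat_imageI[OF add_carrier_vec[OF uv(2,4)]] by simp
    qed
    show "c \<cdot>\<^sub>v u \<in> mat_image B" if im: "u \<in> mat_image B" for c u
    proof -
      obtain u' where u: "u = B *\<^sub>v u'" "u' \<in> carrier_vec (dim_col B)"
        using im unfolding mat_image_def by blast
      then have "c \<cdot>\<^sub>v u = B *\<^sub>v (c \<cdot>\<^sub>v u')" using mult_mat_vec[OF B u(2)] by simp
      then show ?thesis using mat_imageI[of "c \<cdot>\<^sub>v u'" B] u(2) by simp
    qed
  qed (use that in blast)
  define E where "E = 1\<^sub>m m - W * R"
  have E: "E \<in> carrier_mat m m" using W by (auto simp: E_def)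
  have Ev: "E *\<^sub>v v = v - W *\<^sub>v (R *\<^sub>v v)" if "v \<in> carrier_vec m" for v
    unfolding E_def using that W
    by (subst minus_mult_distrib_mat_vec[of _ m m]) (auto simp: assoc_mult_mat_vec[OF W(1,2)])
  have ker: "v \<in> mat_kernel A \<longleftrightarrow> v \<in> carrier_vec m \<and> A *\<^sub>v v = 0\<^sub>v (dim_row A)" for v
    by (auto simp: mat_kernel_def m_def)
  obtain h Z S where Z: "Z \<in> carrier_mat m h" "S \<in> carrier_mat h m" "S * Z = 1\<^sub>m h"
      "\<And>c. c \<in> carrier_vec h \<Longrightarrow> Z *\<^sub>v c \<in> (\<lambda>v. E *\<^sub>v v) ` mat_kernel A"
      "\<And>u. u \<in> (\<lambda>v. E *\<^sub>v v) ` mat_kernel A \<Longrightarrow> Z *\<^sub>v (S *\<^sub>v u) = u"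
  proof (rule subspace_dual_basis)
    show "(\<lambda>v. E *\<^sub>v v) ` mat_kernel A \<subseteq> carrier_vec m" using E by (auto simp: ker)
    have "0\<^sub>v m \<in> mat_kernel A" using mult_mat_zero_vec[OF A] by (simp add: ker)
    then show "0\<^sub>v m \<in> (\<lambda>v. E *\<^sub>v v) ` mat_kernel A"
      using mult_mat_zero_vec[OF E] by (intro image_eqI[of _ _ "0\<^sub>v m"]) simp_all
    show "u + v \<in> (\<lambda>v. E *\<^sub>v v) ` mat_kernel A"
      if im: "u \<in> (\<lambda>v. E *\<^sub>v v) ` mat_kernel A" "v \<in> (\<lambda>v. E *\<^sub>v v) ` mat_kernel A" for u v
    proof -
      obtain u' v' where uv: "u = E *\<^sub>v u'" "u' \<in> mat_kernel A" "v = E *\<^sub>v v'" "v' \<in> mat_kernel A"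
        using im by blast
      then have "u' + v' \<in> mat_kernel A" "u + v = E *\<^sub>v (u' + v')"
        using mult_add_distrib_mat_vec[OF A] mult_add_distrib_mat_vec[OF E] by (auto simp: ker)
      then show ?thesis by blast
    qed
    show "c \<cdot>\<^sub>v u \<in> (\<lambda>v. E *\<^sub>v v) ` mat_kernel A" if im: "u \<in> (\<lambda>v. E *\<^sub>v v) ` mat_kernel A" for c u
    proof -
      obtain u' where u: "u = E *\<^sub>v u'" "u' \<in> mat_kernel A" using im by blast
      then have "c \<cdot>\<^sub>v u' \<in> mat_kernel A" "c \<cdot>\<^sub>v u = E *\<^sub>v (c \<cdot>\<^sub>v u')"
        using mult_mat_vec[OF A] mult_mat_vec[OF E] by (auto simp: ker)
      then show ?thesis by blast
    qed
  qed (use that in blast)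
  have Pv: "(S * E) *\<^sub>v v = S *\<^sub>v (E *\<^sub>v v)" if "v \<in> carrier_vec m" for v
    using assoc_mult_mat_vec[OF Z(2) E that] .
  have "is_coh_proj B A (S * E)"
    unfolding is_coh_proj_def
  proof (intro conjI ballI)
    show "dim_col (S * E) = dim_col A" using E by (simp add: m_def)
    show "(\<lambda>v. (S * E) *\<^sub>v v) ` mat_kernel A = carrier_vec (dim_row (S * E))"
    proof
      show "(\<lambda>v. (S * E) *\<^sub>v v) ` mat_kernel A \<subseteq> carrier_vec (dim_row (S * E))" by (auto intro!: carrier_vecI)
      show "carrier_vec (dim_row (S * E)) \<subseteq> (\<lambda>v. (S * E) *\<^sub>v v) ` mat_kernel A"
      proof
        fix c :: "'k vec" assume "c \<in> carrier_vec (dim_row (S * E))"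
        then have c: "c \<in> carrier_vec h" using Z by simp
        then obtain v where v: "v \<in> mat_kernel A" "Z *\<^sub>v c = E *\<^sub>v v" using Z(4) by blast
        have "(S * E) *\<^sub>v v = c"
          using v c Pv[of v] assoc_mult_mat_vec[OF Z(2,1) c] by (simp add: ker Z(3))
        then show "c \<in> (\<lambda>v. (S * E) *\<^sub>v v) ` mat_kernel A" using v by blast
      qed
    qed
    fix v assume v: "v \<in> mat_kernel A"
    then have vm: "v \<in> carrier_vec m" by (simp add: ker)
    have WRv: "W *\<^sub>v (R *\<^sub>v v) \<in> carrier_vec m" "R *\<^sub>v v \<in> carrier_vec k" using W vm by auto
    show "(S * E) *\<^sub>v v = 0\<^sub>v (dim_row (S * E)) \<longleftrightarrow> v \<in> mat_image B"
    proof
      assume "(S * E) *\<^sub>v v = 0\<^sub>v (dim_row (S * E))"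
      then have "S *\<^sub>v (E *\<^sub>v v) = 0\<^sub>v h" using Pv[OF vm] Z by simp
      moreover have "Z *\<^sub>v (S *\<^sub>v (E *\<^sub>v v)) = E *\<^sub>v v" using Z(5) v by blast
      ultimately have "E *\<^sub>v v = 0\<^sub>v m" using mult_mat_zero_vec[OF Z(1)] by simp
      then have *: "v - W *\<^sub>v (R *\<^sub>v v) = 0\<^sub>v m" using Ev[OF vm] by simp
      have "v = W *\<^sub>v (R *\<^sub>v v)" by (rule vec_minus_eq_0[OF vm WRv(1) *])
      then show "v \<in> mat_image B" using W(3)[OF WRv(2)] by simp
    next
      assume "v \<in> mat_image B"
      then have "E *\<^sub>v v = 0\<^sub>v m" using W(4) Ev[OF vm] vm by simp
      then show "(S * E) *\<^sub>v v = 0\<^sub>v (dim_row (S * E))"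
        using Pv[OF vm] mult_mat_zero_vec[OF Z(2)] Z(2) by simp
    qed
  qed
  then show ?thesis by blast
qed

text \<open>
  The description in \<open>induced\<close> has exactly one solution \<open>P' F V\<close>, where \<open>V\<close> lifts the standard basis
  of the quotient to \<open>ker A\<close>. The matrices \<open>F0\<close> and \<open>F1\<close> are the components of the morphism of
  complexes in the neighbouring degrees; they make \<open>F\<close> preserve the image of \<open>B\<close> and the kernel
  of \<open>A\<close>.
\<close>

lemma induced_carrier:
  fixes A B P :: "'k::field mat"
  assumes P: "is_coh_proj B A P" and P': "is_coh_proj B' A' P'"
    and B: "dim_row B = dim_col A"
    and F: "F \<in> carrier_mat (dim_col A') (dim_col A)"
    and F0: "F0 \<in> carrier_mat (dim_col B') (dim_col B)" "F * B = B' * F0"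
    and F1: "F1 \<in> carrier_mat (dim_row A') (dim_row A)" "A' * F = F1 * A"
    and B': "dim_row B' = dim_col A'"
  shows "induced A P P' F \<in> carrier_mat (dim_row P') (dim_row P)"
proof -
  define h where "h = dim_row P"
  define m where "m = dim_col A"
  have Pc: "P \<in> carrier_mat h m" and onto: "(\<lambda>v. P *\<^sub>v v) ` mat_kernel A = carrier_vec h"
    and Pz: "\<And>v. v \<in> mat_kernel A \<Longrightarrow> P *\<^sub>v v = 0\<^sub>v h \<longleftrightarrow> v \<in> mat_image B"
    using P by (auto simp: is_coh_proj_def h_def m_def)
  have Pc': "P' \<in> carrier_mat (dim_row P') (dim_col A')"
    and Pz': "\<And>v. v \<in> mat_kernel A' \<Longrightarrow> P' *\<^sub>v v = 0\<^sub>v (dim_row P') \<longleftrightarrow> v \<in> mat_image B'"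
    using P' by (auto simp: is_coh_proj_def)
  have Ac: "A \<in> carrier_mat (dim_row A) m" and Ac': "A' \<in> carrier_mat (dim_row A') (dim_col A')"
    and Fc: "F \<in> carrier_mat (dim_col A') m" and Bc: "B \<in> carrier_mat m (dim_col B)"
    and Bc': "B' \<in> carrier_mat (dim_col A') (dim_col B')"
    using F B B' by (auto simp: m_def)
  have ker: "v \<in> mat_kernel A \<longleftrightarrow> v \<in> carrier_vec m \<and> A *\<^sub>v v = 0\<^sub>v (dim_row A)" for v
    by (auto simp: mat_kernel_def m_def)
  have "\<forall>j<h. \<exists>v. v \<in> mat_kernel A \<and> P *\<^sub>v v = unit_vec h j"
    using onto by (metis imageE unit_vec_carrier)
  then obtain s where s: "\<And>j. j < h \<Longrightarrow> s j \<in> mat_kernel A" "\<And>j. j < h \<Longrightarrow> P *\<^sub>v s j = unit_vec h j"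
    by metis
  define V where "V = mat m h (\<lambda>(i, j). s j $ i)"
  have Vc: "V \<in> carrier_mat m h" by (simp add: V_def)
  have colV: "col V j = s j" if "j < h" for j
    using that s(1)[OF that] by (intro eq_vecI) (auto simp: V_def ker)
  have PV: "P * V = 1\<^sub>m h"
  proof (rule eq_matI)
    fix i j assume ij: "i < dim_row (1\<^sub>m h)" "j < dim_col (1\<^sub>m h)"
    then show "(P * V) $$ (i, j) = 1\<^sub>m h $$ (i, j)"
      using arg_cong[OF s(2)[of j], of "\<lambda>v. v $ i"] Pc Vc by (simp add: colV)
  qed (use Pc Vc in auto)
  have AV: "A * V = 0\<^sub>m (dim_row A) h"
  proof (rule eq_matI)
    fix i j assume ij: "i < dim_row (0\<^sub>m (dim_row A) h)" "j < dim_col (0\<^sub>m (dim_row A) h)"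
    then have "A *\<^sub>v s j = 0\<^sub>v (dim_row A)" using s(1) by (simp add: ker)
    from arg_cong[OF this, of "\<lambda>v. v $ i"]
    show "(A * V) $$ (i, j) = 0\<^sub>m (dim_row A) h $$ (i, j)"
      using ij Vc by (simp add: colV)
  qed (use Vc in auto)
  have Fker: "F *\<^sub>v v \<in> mat_kernel A'" if "v \<in> mat_kernel A" for v
  proof -
    have v: "v \<in> carrier_vec m" "A *\<^sub>v v = 0\<^sub>v (dim_row A)" using that by (auto simp: ker)
    have "A' *\<^sub>v (F *\<^sub>v v) = F1 *\<^sub>v (A *\<^sub>v v)"
      using assoc_mult_mat_vec[OF Ac' Fc v(1)] assoc_mult_mat_vec[OF F1(1) Ac v(1)] F1(2) by simp
    then have "A' *\<^sub>v (F *\<^sub>v v) = 0\<^sub>v (dim_row A')" using v(2) mult_mat_zero_vec[OF F1(1)] by simp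
    then show ?thesis using v Fc by (auto simp: mat_kernel_def)
  qed
  have Fim: "P' *\<^sub>v (F *\<^sub>v v) = 0\<^sub>v (dim_row P')" if "v \<in> mat_kernel A" "P *\<^sub>v v = 0\<^sub>v h" for v
  proof -
    have "v \<in> mat_image B" using Pz[OF that(1)] that(2) by simp
    then obtain u where u: "u \<in> carrier_vec (dim_col B)" "v = B *\<^sub>v u"
      unfolding mat_image_def by blast
    have "F *\<^sub>v v = B' *\<^sub>v (F0 *\<^sub>v u)"
      using assoc_mult_mat_vec[OF Fc Bc u(1)] assoc_mult_mat_vec[OF Bc' F0(1) u(1)] F0(2) u(2) by simp
    moreover have "F0 *\<^sub>v u \<in> carrier_vec (dim_col B')" using F0(1) u(1) by simp
    ultimately have "F *\<^sub>v v \<in> mat_image B'" unfolding mat_image_def by blast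
    then show ?thesis using Pz'[OF Fker[OF that(1)]] by blast
  qed
  have PFc: "P' * F \<in> carrier_mat (dim_row P') m" by (rule mult_carrier_mat[OF Pc' Fc])
  define N where "N = P' * F * V"
  have Nc: "N \<in> carrier_mat (dim_row P') h" using PFc Vc by (simp add: N_def)
  have N: "N *\<^sub>v (P *\<^sub>v v) = P' *\<^sub>v (F *\<^sub>v v)" if v: "v \<in> mat_kernel A" for v
  proof -
    have vm: "v \<in> carrier_vec m" and Pv: "P *\<^sub>v v \<in> carrier_vec h" using v Pc by (auto simp: ker)
    have VPv: "V *\<^sub>v (P *\<^sub>v v) \<in> carrier_vec m" using Vc Pv by simp
    define z where "z = v - V *\<^sub>v (P *\<^sub>v v)"
    have zm: "z \<in> carrier_vec m" using vm VPv by (simp add: z_def)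
    have "A *\<^sub>v (V *\<^sub>v (P *\<^sub>v v)) = 0\<^sub>v (dim_row A)"
      using assoc_mult_mat_vec[OF Ac Vc Pv] zero_mat_mult_vec[OF Pv] by (simp add: AV)
    then have "A *\<^sub>v z = 0\<^sub>v (dim_row A)"
      using mult_minus_distrib_mat_vec[OF Ac vm VPv] v by (simp add: z_def ker)
    moreover have "P *\<^sub>v z = 0\<^sub>v h"
      using mult_minus_distrib_mat_vec[OF Pc vm VPv] assoc_mult_mat_vec[OF Pc Vc Pv] PV Pv by (simp add: z_def)
    ultimately have "P' *\<^sub>v (F *\<^sub>v z) = 0\<^sub>v (dim_row P')" using Fim zm ker by blast
    then have "(P' * F) *\<^sub>v z = 0\<^sub>v (dim_row P')" using assoc_mult_mat_vec[OF Pc' Fc zm] by simp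
    then have *: "(P' * F) *\<^sub>v v - (P' * F) *\<^sub>v (V *\<^sub>v (P *\<^sub>v v)) = 0\<^sub>v (dim_row P')"
      using mult_minus_distrib_mat_vec[OF PFc vm VPv] by (simp add: z_def)
    have "N *\<^sub>v (P *\<^sub>v v) = (P' * F) *\<^sub>v (V *\<^sub>v (P *\<^sub>v v))"
      unfolding N_def by (rule assoc_mult_mat_vec[OF PFc Vc Pv])
    also have "\<dots> = (P' * F) *\<^sub>v v"
      by (rule vec_minus_eq_0[symmetric, OF mult_mat_vec_carrier[OF PFc vm] mult_mat_vec_carrier[OF PFc VPv] *])
    also have "\<dots> = P' *\<^sub>v (F *\<^sub>v v)" by (rule assoc_mult_mat_vec[OF Pc' Fc vm])
    finally show ?thesis .
  qed
  have "\<exists>!K. K \<in> carrier_mat (dim_row P') (dim_row P) \<and>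
      (\<forall>v\<in>mat_kernel A. K *\<^sub>v (P *\<^sub>v v) = P' *\<^sub>v (F *\<^sub>v v))"
  proof (rule ex1I)
    show "N \<in> carrier_mat (dim_row P') (dim_row P) \<and> (\<forall>v\<in>mat_kernel A. N *\<^sub>v (P *\<^sub>v v) = P' *\<^sub>v (F *\<^sub>v v))"
      using Nc N by (simp add: h_def)
    fix K assume "K \<in> carrier_mat (dim_row P') (dim_row P) \<and>
      (\<forall>v\<in>mat_kernel A. K *\<^sub>v (P *\<^sub>v v) = P' *\<^sub>v (F *\<^sub>v v))"
    then have Kc: "K \<in> carrier_mat (dim_row P') h"
      and K: "\<And>v. v \<in> mat_kernel A \<Longrightarrow> K *\<^sub>v (P *\<^sub>v v) = P' *\<^sub>v (F *\<^sub>v v)"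
      by (auto simp: h_def)
    show "K = N"
    proof (rule eq_matI)
      fix i j assume ij: "i < dim_row N" "j < dim_col N"
      then have j: "j < h" using Nc by simp
      have "K *\<^sub>v unit_vec h j = N *\<^sub>v unit_vec h j"
        using K[OF s(1)[OF j]] N[OF s(1)[OF j]] s(2)[OF j] by simp
      from arg_cong[OF this, of "\<lambda>v. v $ i"] show "K $$ (i, j) = N $$ (i, j)"
        using ij j carrier_matD[OF Kc] carrier_matD[OF Nc] by simp
    qed (use carrier_matD[OF Kc] carrier_matD[OF Nc] in simp_all)
  qed
  from theI'[OF this] show ?thesis unfolding induced_def by (rule conjunct1)
qed

lemma cohom_is_rep:
  fixes C :: "'k::field cx"
  assumes C: "is_bounded_cx n equi C"
  shows "is_rep n equi (cohom equi i C)"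
proof -
  have rep: "is_rep n equi (deg C i)" and hom: "diff C i \<in> rep_hom equi (deg C i) (deg C (i + 1))" for i
    using C by (auto simp: is_bounded_cx_def)
  note d = rep_hom_equiD[OF hom] is_rep_equiD(1,2)[OF rep]
  have row: "dim_row (diff C (i - 1) x) = vdim (deg C i) x" for x
    using d(1)[of "i - 1"] by simp
  have P: "is_coh_proj (diff C (i - 1) x) (diff C i x) (cx_proj C i x)" for x
    unfolding cx_proj_def coh_proj_def
    by (rule someI_ex, rule coh_proj_exists) (simp add: d row)
  show ?thesis
    unfolding is_rep_def
  proof (intro conjI allI impI)
    fix x :: nat assume "x \<notin> {1..n}"
    then have "vdim (deg C i) x = 0" using rep[of i] by (simp add: is_rep_def)
    then have col: "dim_col (diff C i x) = 0" by (simp add: d)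
    have "dim_row (cx_proj C i x) = 0"
    proof (rule ccontr)
      assume ne: "dim_row (cx_proj C i x) \<noteq> 0"
      have "unit_vec (dim_row (cx_proj C i x)) 0 \<in> (\<lambda>v. cx_proj C i x *\<^sub>v v) ` mat_kernel (diff C i x)"
        using P[of x] by (simp add: is_coh_proj_def)
      then obtain v where v: "v \<in> carrier_vec 0" "unit_vec (dim_row (cx_proj C i x)) 0 = cx_proj C i x *\<^sub>v v"
        using col by (auto simp: mat_kernel_def)
      from arg_cong[OF v(2), of "\<lambda>v. v $ 0"] show False
        using ne v(1) by (simp add: scalar_prod_def)
    qed
    then show "vdim (cohom equi i C) x = 0" by (simp add: cohom_def)
  next
    fix j
    have nat: "arr (deg C i) j * diff C (i - 1) j = diff C (i - 1) (Suc j) * arr (deg C (i - 1)) j"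
      using d(3)[of "i - 1" j] by simp
    have "induced (diff C i j) (cx_proj C i j) (cx_proj C i (Suc j)) (arr (deg C i) j)
        \<in> carrier_mat (dim_row (cx_proj C i (Suc j))) (dim_row (cx_proj C i j))"
      by (rule induced_carrier[OF P P _ _ _ nat _ d(3)]) (auto simp: d row)
    then show "arr (cohom equi i C) j \<in> carrier_mat (vdim (cohom equi i C) (atgt equi j)) (vdim (cohom equi i C) (asrc equi j))"
      by (simp add: cohom_def)
  qed
qed

section \<open>The inequality between the distances\<close>

lemma Mor_Db_imp_bounded:
  assumes "\<phi> \<in> Mor (Db n a) C D"
  shows "is_bounded_cx n a C"
  using assms by (auto simp: Db_def is_roof_def)

text \<open>
  Morphisms exist only between bounded complexes, so the cohomologies are representations, and
  stability applies to them.
\<close>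

lemma derived_interleaved_imp_matching:
  assumes "derived_interleaved n \<delta> C D"
  shows "\<exists>\<sigma>. is_matching \<delta> (barcode_D n C i) (barcode_D n D i) \<sigma>"
proof -
  obtain \<phi> \<gamma> where \<phi>: "\<phi> \<in> Mor (Db n equi) C (cx_shift n \<delta> D)" and \<gamma>: "\<gamma> \<in> Mor (Db n equi) D (cx_shift n \<delta> C)"
    and "interleaving_pair n \<delta> (cohom equi i C) (cohom equi i D) (Db_cohom equi i \<phi>) (Db_cohom equi i \<gamma>)"
    using assms unfolding derived_interleaved_def by blast
  then show ?thesis
    unfolding barcode_D_def
    by (intro algebraic_stability[OF cohom_is_rep[OF Mor_Db_imp_bounded[OF \<phi>]] cohom_is_rep[OF Mor_Db_imp_bounded[OF \<gamma>]]])
qed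

lemma dB_D_le_dI_D: "dB_D (barcode_D n C) (barcode_D n D) \<le> dI_D n C D"
  unfolding dB_D_def dI_D_def
  by (rule Inf_superset_mono) (use derived_interleaved_imp_matching in blast)

theorem theorem4p14:
  fixes n :: nat
    and a :: "nat \<Rightarrow> bool"
    and \<Sigma> :: "nat \<Rightarrow> 'k::alg_closed_field rep"
    and \<psi> :: "nat \<Rightarrow> nat"
    and \<alpha> :: "nat \<Rightarrow> 'k rmap"
    and E :: "'k Db_functor"
    and X Y :: "'k rep"
  assumes "n \<ge> 1"
    and "is_section n \<Sigma>"
    and "op_section_iso n a \<Sigma> \<psi>"
    and "arrow_choice n a \<Sigma> \<psi> \<alpha>"
    and "quasi_inverse (Db n equi) (Db n a) (RHomT n a \<Sigma> \<psi> \<alpha>) E"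
    and "is_rep n a X"
    and "is_rep n a Y"
  shows "dB_T n E X Y \<le> dI_T n E X Y"
  unfolding dB_T_def dI_T_def by (rule dB_D_le_dI_D)

end
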